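(* Let $G$ and $H$ be finitely generated groups, let $\mathcal{P}$ be a finite collection of subgroups of $G$ and $\mathcal{Q}$ a finite collection of subgroups of $H$. Let $q\colon(G,\mathcal{P})\to(H,\mathcal{Q})$ be a quasi-isometry of pairs. If $\mathcal{Q}$ is an almost malnormal collection of infinite subgroups, then any refinement $\mathcal{P}^*$ of $\mathcal{P}$ is almost malnormal and $q\colon(G,\mathcal{P}^* )\to(H,\mathcal{Q})$ is a quasi-isometry of pairs.
   Context: **Quasi-isometry of pairs.** Fix word metrics on $G$, $H$ with respect to finite generating sets. $\mathsf{hdist}_H$ denotes Hausdorff distance between subsets of $H$; $G/\mathcal{P}$ is the set of all left cosets $gP$ with $g\in G$, $P\in\mathcal{P}$. For $L\ge1$, $C,M\ge0$, an $(L,C,M)$-quasi-isometry of pairs $q\colon(G,\mathcal{P})\to(H,\mathcal{Q})$ is an $(L,C)$-quasi-isometry $q\colon G\to H$ such that the relation $\dot q=\{(A,B)\in G/\mathcal{P}\times H/\mathcal{Q}\colon\mathsf{hdist}_H(q(A),B)<M\}$ has surjective projections to $G/\mathcal{P}$ and $H/\mathcal{Q}$. A quasi-isometry of pairs is an $(L,C,M)$-quasi-isometry of pairs for some constants. **Refinement.** The commensurator of $P\le G$ is $\mathrm{Comm}_G(P)=\{g\in G: P\cap gPg^{-1}\text{ has finite index in both }P\text{ and }gPg^{-1}\}$. A refinement $\mathcal{P}^*$ of $\mathcal{P}$ is a set of representatives of the conjugacy classes of the collection of subgroups $\{\mathrm{Comm}_G(gPg^{-1})\colon P\in\mathcal{P},\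 g\in G\}$. **Almost malnormal.** A collection $\mathcal{P}$ of subgroups of $G$ is almost malnormal if for any $P,P'\in\mathcal{P}$ and $g\in G$, either $gPg^{-1}\cap P'$ is finite, or $P=P'$ and $g\in P$. *)

theory Defs
  imports
    "HOL-Algebra.Left_Coset"
    "HOL-Algebra.Generated_Groups"
    "HOL-Library.Extended_Nonnegative_Real"
begin

definition finite_generating_set :: "('a, 'm) monoid_scheme \<Rightarrow> 'a set \<Rightarrow> bool" where
  "finite_generating_set G S \<longleftrightarrow> finite S \<and> S \<subseteq> carrier G \<and> generate G S = carrier G"

(* Meaningful only when S generates G, so that the set of admissible n is nonempty. *)
definition word_length :: "('a, 'm) monoid_scheme \<Rightarrow> 'a set \<Rightarrow> 'a \<Rightarrow> nat" where
  "word_length G S g =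
     (LEAST n. \<exists>ws. set ws \<subseteq> S \<union> (\<lambda>s. inv\<^bsub>G\<^esub> s) ` S \<and> length ws = n
                   \<and> foldr (\<otimes>\<^bsub>G\<^esub>) ws \<one>\<^bsub>G\<^esub> = g)"

(* The left-invariant word metric, matching the use of left cosets below. *)
definition word_dist :: "('a, 'm) monoid_scheme \<Rightarrow> 'a set \<Rightarrow> 'a \<Rightarrow> 'a \<Rightarrow> real" where
  "word_dist G S x y = real (word_length G S (inv\<^bsub>G\<^esub> x \<otimes>\<^bsub>G\<^esub> y))"

definition quasi_isometry ::
    "real \<Rightarrow> real \<Rightarrow> 'a set \<Rightarrow> ('a \<Rightarrow> 'a \<Rightarrow> real) \<Rightarrow> 'b set \<Rightarrow> ('b \<Rightarrow> 'b \<Rightarrow> real) \<Rightarrow> ('a \<Rightarrow> 'b) \<Rightarrow> bool" where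
  "quasi_isometry L C X dX Y dY q \<longleftrightarrow>
     L \<ge> 1 \<and> C \<ge> 0 \<and> q \<in> X \<rightarrow> Y \<and>
     (\<forall>x\<in>X. \<forall>y\<in>X. dX x y / L - C \<le> dY (q x) (q y) \<and> dY (q x) (q y) \<le> L * dX x y + C) \<and>
     (\<forall>y\<in>Y. \<exists>x\<in>X. dY (q x) y \<le> C)"

(* Hausdorff distance with values in [0, \<infinity>]; cosets may be infinitely far apart. *)
definition hdist :: "('a \<Rightarrow> 'a \<Rightarrow> real) \<Rightarrow> 'a set \<Rightarrow> 'a set \<Rightarrow> ennreal" where
  "hdist d A B = max (SUP a\<in>A. INF b\<in>B. ennreal (d a b)) (SUP b\<in>B. INF a\<in>A. ennreal (d a b))"

definition left_cosets_of :: "('a, 'm) monoid_scheme \<Rightarrow> 'a set set \<Rightarrow> 'a set set" where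
  "left_cosets_of G \<P> = (\<Union>P\<in>\<P>. lcosets\<^bsub>G\<^esub> P)"

definition coset_relation ::
    "('a, 'm) monoid_scheme \<Rightarrow> 'a set set \<Rightarrow> ('b, 'n) monoid_scheme \<Rightarrow> 'b set \<Rightarrow> 'b set set
      \<Rightarrow> real \<Rightarrow> ('a \<Rightarrow> 'b) \<Rightarrow> ('a set \<times> 'b set) set" where
  "coset_relation G \<P> H T \<Q> M q =
     {(A, B) \<in> left_cosets_of G \<P> \<times> left_cosets_of H \<Q>. hdist (word_dist H T) (q ` A) B < ennreal M}"

definition quasi_isometry_of_pairs_with ::
    "real \<Rightarrow> real \<Rightarrow> real \<Rightarrow> ('a, 'm) monoid_scheme \<Rightarrow> 'a set \<Rightarrow> 'a set set
      \<Rightarrow> ('b, 'n) monoid_scheme \<Rightarrow> 'b set \<Rightarrow> 'b set set \<Rightarrow> ('a \<Rightarrow> 'b) \<Rightarrow> bool" where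
  "quasi_isometry_of_pairs_with L C M G S \<P> H T \<Q> q \<longleftrightarrow>
     M \<ge> 0 \<and>
     quasi_isometry L C (carrier G) (word_dist G S) (carrier H) (word_dist H T) q \<and>
     fst ` coset_relation G \<P> H T \<Q> M q = left_cosets_of G \<P> \<and>
     snd ` coset_relation G \<P> H T \<Q> M q = left_cosets_of H \<Q>"

definition quasi_isometry_of_pairs ::
    "('a, 'm) monoid_scheme \<Rightarrow> 'a set \<Rightarrow> 'a set set
      \<Rightarrow> ('b, 'n) monoid_scheme \<Rightarrow> 'b set \<Rightarrow> 'b set set \<Rightarrow> ('a \<Rightarrow> 'b) \<Rightarrow> bool" where
  "quasi_isometry_of_pairs G S \<P> H T \<Q> q \<longleftrightarrow>
     (\<exists>L C M. quasi_isometry_of_pairs_with L C M G S \<P> H T \<Q> q)"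

definition conjugate :: "('a, 'm) monoid_scheme \<Rightarrow> 'a \<Rightarrow> 'a set \<Rightarrow> 'a set" where
  "conjugate G g P = g <#\<^bsub>G\<^esub> P #>\<^bsub>G\<^esub> inv\<^bsub>G\<^esub> g"

definition finite_index :: "('a, 'm) monoid_scheme \<Rightarrow> 'a set \<Rightarrow> 'a set \<Rightarrow> bool" where
  "finite_index G K P \<longleftrightarrow> finite (rcosets\<^bsub>G\<lparr>carrier := P\<rparr>\<^esub> K)"

definition commensurator :: "('a, 'm) monoid_scheme \<Rightarrow> 'a set \<Rightarrow> 'a set" where
  "commensurator G P =
     {g \<in> carrier G. finite_index G (P \<inter> conjugate G g P) P \<and>
                     finite_index G (P \<inter> conjugate G g P) (conjugate G g P)}"

definition commensurators_of_conjugates :: "('a, 'm) monoid_scheme \<Rightarrow> 'a set set \<Rightarrow> 'a set set" where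
  "commensurators_of_conjugates G \<P> = {commensurator G (conjugate G g P) | g P. P \<in> \<P> \<and> g \<in> carrier G}"

definition conjugacy_class :: "('a, 'm) monoid_scheme \<Rightarrow> 'a set \<Rightarrow> 'a set set" where
  "conjugacy_class G K = (\<lambda>g. conjugate G g K) ` carrier G"

definition refinement :: "('a, 'm) monoid_scheme \<Rightarrow> 'a set set \<Rightarrow> 'a set set \<Rightarrow> bool" where
  "refinement G \<P> \<R> \<longleftrightarrow>
     \<R> \<subseteq> commensurators_of_conjugates G \<P> \<and>
     (\<forall>\<C> \<in> conjugacy_class G ` commensurators_of_conjugates G \<P>. \<exists>!R. R \<in> \<R> \<and> R \<in> \<C>)"

definition almost_malnormal :: "('a, 'm) monoid_scheme \<Rightarrow> 'a set set \<Rightarrow> bool" where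
  "almost_malnormal G \<P> \<longleftrightarrow>
     (\<forall>P\<in>\<P>. \<forall>P'\<in>\<P>. \<forall>g\<in>carrier G. finite (conjugate G g P \<inter> P') \<or> (P = P' \<and> g \<in> P))"

end

theory Submission
  imports Defs
begin

text \<open>
  Call two subsets of a group coarsely equal if they are at finite Hausdorff distance. For a subgroup
  \<open>P\<close> an element \<open>g\<close> commensurates \<open>P\<close> iff \<open>gP\<close> and \<open>P\<close> are coarsely equal. In \<open>H\<close>, two cosets of
  members of \<open>\<Q>\<close> that stay within bounded distance along an infinite set are equal, by the pigeonhole
  principle and almost malnormality. Hence every coset \<open>gP\<close> in \<open>G\<close> has exactly one partner in \<open>H/\<Q>\<close>,
  and coarsely equal cosets share it. As the commensurator \<open>K\<close> of \<open>P\<close> is the union of cosets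
  \<open>kP\<close> coarsely equal to \<open>P\<close>, all with the same partner and the same constant \<open>M\<close>, the image of \<open>K\<close>
  itself is uniformly close to that partner. This gives the quasi-isometry of pairs, and shows that \<open>K\<close>
  is coarsely equal to \<open>P\<close>. If \<open>gRg\<inverse> \<inter> R'\<close> is infinite for refined subgroups, the partners of the
  underlying cosets agree, so these cosets are coarsely equal; thus \<open>gRg\<inverse> = R'\<close>, whence \<open>R = R'\<close>
  and \<open>g\<close> commensurates the subgroup underlying \<open>R\<close>.
\<close>

section \<open>Coarse containment, coarse equality and Hausdorff distance\<close>

text \<open>Finite Hausdorff distance is split into two one-sided halves, because commensuration is
  a pair of index conditions and each of them matches one half.\<close>

definition coarse_subset :: "('a \<Rightarrow> 'a \<Rightarrow> real) \<Rightarrow> 'a set \<Rightarrow> 'a set \<Rightarrow> bool" where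
  "coarse_subset d A B \<longleftrightarrow> (\<exists>r. \<forall>a\<in>A. \<exists>b\<in>B. d a b \<le> r)"

definition coarse_equal :: "('a \<Rightarrow> 'a \<Rightarrow> real) \<Rightarrow> 'a set \<Rightarrow> 'a set \<Rightarrow> bool" where
  "coarse_equal d A B \<longleftrightarrow> coarse_subset d A B \<and> coarse_subset d B A"

text \<open>Unlike an infinite intersection, this relation survives moving \<open>A\<close> and
  \<open>B\<close> by bounded amounts and passing through a quasi-isometry.\<close>

definition coarse_overlap :: "('a \<Rightarrow> 'a \<Rightarrow> real) \<Rightarrow> 'a set \<Rightarrow> 'a set \<Rightarrow> bool" where
  "coarse_overlap d A B \<longleftrightarrow> (\<exists>I\<subseteq>A. infinite I \<and> coarse_subset d I B)"

lemma coarse_subset_mono: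
  "coarse_subset d A B \<Longrightarrow> A' \<subseteq> A \<Longrightarrow> coarse_subset d A' B"
  unfolding coarse_subset_def by blast

lemma coarse_equal_sym: "coarse_equal d A B \<Longrightarrow> coarse_equal d B A"
  by (simp add: coarse_equal_def)

lemma hdist_less_imp:
  assumes "hdist d A B < ennreal M"
  shows "\<forall>a\<in>A. \<exists>b\<in>B. d a b \<le> M" and "\<forall>b\<in>B. \<exists>a\<in>A. d a b \<le> M"
proof -
  have 1: "(SUP a\<in>A. INF b\<in>B. ennreal (d a b)) < ennreal M"
    and 2: "(SUP b\<in>B. INF a\<in>A. ennreal (d a b)) < ennreal M"
    using assms by (auto simp: hdist_def)
  show "\<forall>a\<in>A. \<exists>b\<in>B. d a b \<le> M"
  proof
    fix a assume "a \<in> A"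
    then have "(INF b\<in>B. ennreal (d a b)) < ennreal M"
      using 1 by (rule le_less_trans[OF SUP_upper])
    then obtain b where "b \<in> B" "ennreal (d a b) < ennreal M" by (auto simp: INF_less_iff)
    then show "\<exists>b\<in>B. d a b \<le> M" using ennreal_leI[of M "d a b"] by force
  qed
  show "\<forall>b\<in>B. \<exists>a\<in>A. d a b \<le> M"
  proof
    fix b assume "b \<in> B"
    then have "(INF a\<in>A. ennreal (d a b)) < ennreal M"
      using 2 by (rule le_less_trans[OF SUP_upper])
    then obtain a where "a \<in> A" "ennreal (d a b) < ennreal M" by (auto simp: INF_less_iff)
    then show "\<exists>a\<in>A. d a b \<le> M" using ennreal_leI[of M "d a b"] by force
  qed
qed

text \<open>Pointwise bounds by \<open>r\<close> only bound the suprema by \<open>r\<close>; the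
  extra 1 restores the strict inequality demanded by \<open>coset_relation\<close>.\<close>

lemma hdist_less_succ:
  assumes "\<forall>a\<in>A. \<exists>b\<in>B. d a b \<le> r" and "\<forall>b\<in>B. \<exists>a\<in>A. d a b \<le> r" and "0 \<le> r"
  shows "hdist d A B < ennreal (r + 1)"
proof -
  have "(SUP a\<in>A. INF b\<in>B. ennreal (d a b)) \<le> ennreal r"
    using assms(1) by (auto intro!: SUP_least intro: INF_lower2 ennreal_leI)
  moreover have "(SUP b\<in>B. INF a\<in>A. ennreal (d a b)) \<le> ennreal r"
    using assms(2) by (auto intro!: SUP_least intro: INF_lower2 ennreal_leI)
  ultimately have "hdist d A B \<le> ennreal r" by (simp add: hdist_def)
  also have "\<dots> < ennreal (r + 1)" using assms(3) by (intro ennreal_lessI) auto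
  finally show ?thesis .
qed

section \<open>Coarse relations in a space with finite balls\<close>

locale proper_metric =
  fixes X :: "'a set" and d :: "'a \<Rightarrow> 'a \<Rightarrow> real"
  assumes nonneg: "0 \<le> d x y"
    and dist_self: "x \<in> X \<Longrightarrow> d x x = 0"
    and dist_sym: "x \<in> X \<Longrightarrow> y \<in> X \<Longrightarrow> d x y = d y x"
    and triangle: "x \<in> X \<Longrightarrow> y \<in> X \<Longrightarrow> z \<in> X \<Longrightarrow> d x z \<le> d x y + d y z"
    and finite_ball: "x \<in> X \<Longrightarrow> finite {y \<in> X. d x y \<le> r}"
begin

lemma coarse_subset_trans:
  assumes "coarse_subset d A B" "coarse_subset d B C" "A \<subseteq> X" "B \<subseteq> X" "C \<subseteq> X"
  shows "coarse_subset d A C"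
proof -
  obtain r s where r: "\<And>a. a \<in> A \<Longrightarrow> \<exists>b\<in>B. d a b \<le> r" and s: "\<And>b. b \<in> B \<Longrightarrow> \<exists>c\<in>C. d b c \<le> s"
    using assms unfolding coarse_subset_def by blast
  have "\<exists>c\<in>C. d a c \<le> r + s" if "a \<in> A" for a
  proof -
    obtain b c where "b \<in> B" "d a b \<le> r" "c \<in> C" "d b c \<le> s" using r s \<open>a \<in> A\<close> by blast
    then show ?thesis using triangle[of a b c] that assms by force
  qed
  then show ?thesis unfolding coarse_subset_def by blast
qed

lemma coarse_subset_refl: "A \<subseteq> X \<Longrightarrow> coarse_subset d A A"
  unfolding coarse_subset_def using dist_self by (metis order_refl subsetD)

lemma coarse_equal_refl: "A \<subseteq> X \<Longrightarrow> coarse_equal d A A"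
  by (simp add: coarse_equal_def coarse_subset_refl)

lemma coarse_equal_trans:
  assumes "coarse_equal d A B" "coarse_equal d B C" "A \<subseteq> X" "B \<subseteq> X" "C \<subseteq> X"
  shows "coarse_equal d A C"
  using assms coarse_subset_trans[of A B C] coarse_subset_trans[of C B A]
  by (simp add: coarse_equal_def)

text \<open>A finite image would force an infinite fibre, and that fibre would sit inside a single
  finite ball.\<close>

lemma infinite_image_bounded_fibres:
  assumes "infinite I" "I \<subseteq> X" and "\<And>a b. a \<in> I \<Longrightarrow> b \<in> I \<Longrightarrow> f a = f b \<Longrightarrow> d a b \<le> r"
  shows "infinite (f ` I)"
proof
  assume "finite (f ` I)"
  then obtain a where a: "a \<in> I" "infinite {b \<in> I. f b = f a}"
    using pigeonhole_infinite[OF assms(1)] by blast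
  have "{b \<in> I. f b = f a} \<subseteq> {b \<in> X. d a b \<le> r}"
    using assms(2,3) a(1) by fastforce
  then show False using a finite_ball[of a r] assms(2) finite_subset by blast
qed

text \<open>The infinite set witnessing the overlap is carried into \<open>A'\<close> by a map
  \<open>f\<close> of bounded displacement; such a map has bounded fibres, so the image is again
  infinite, and it stays close to \<open>B\<close> and hence to \<open>B'\<close>.\<close>

lemma coarse_overlap_trans:
  assumes "coarse_overlap d A B" "coarse_subset d A A'" "coarse_subset d B B'"
    and sub: "A \<subseteq> X" "A' \<subseteq> X" "B \<subseteq> X" "B' \<subseteq> X"
  shows "coarse_overlap d A' B'"
proof -
  obtain I where I: "I \<subseteq> A" "infinite I" "coarse_subset d I B"
    using assms unfolding coarse_overlap_def by blast
  obtain r where "\<forall>a\<in>A. \<exists>a'\<in>A'. d a a' \<le> r" using assms unfolding coarse_subset_def by blast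
  then obtain f where f: "\<And>a. a \<in> A \<Longrightarrow> f a \<in> A' \<and> d a (f a) \<le> r" by metis
  have "infinite (f ` I)"
  \<comment> \<open>Two points with the same image are each within \<open>r\<close> of it.\<close>
  proof (rule infinite_image_bounded_fibres[where r = "2 * r"])
    fix a b assume "a \<in> I" "b \<in> I" "f a = f b"
    then have "d a (f a) \<le> r" "d b (f a) \<le> r" "a \<in> X" "b \<in> X" "f a \<in> X"
      using f I sub by (metis subsetD)+
    then show "d a b \<le> 2 * r" using triangle[of a "f a" b] dist_sym[of b "f a"] by simp
  qed (use I sub in auto)
  moreover have "coarse_subset d (f ` I) I"
    unfolding coarse_subset_def
  proof (intro exI[of _ r] ballI)
    fix y assume "y \<in> f ` I"
    then obtain a where a: "a \<in> I" "y = f a" by blast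
    then have "a \<in> X" "y \<in> X" "d a y \<le> r" using f[of a] I sub by blast+
    then have "d y a \<le> r" by (simp add: dist_sym)
    then show "\<exists>a\<in>I. d y a \<le> r" using a by blast
  qed
  moreover have "f ` I \<subseteq> A'" using f I by blast
  moreover have "I \<subseteq> X" "f ` I \<subseteq> X" using \<open>f ` I \<subseteq> A'\<close> I sub by auto
  ultimately show ?thesis
    unfolding coarse_overlap_def
    using coarse_subset_trans[of "f ` I" I B] coarse_subset_trans[of "f ` I" B B'] I assms(3) sub
    by blast
qed

lemma coarse_overlap_refl: "A \<subseteq> X \<Longrightarrow> infinite A \<Longrightarrow> coarse_overlap d A A"
  unfolding coarse_overlap_def using coarse_subset_refl by blast

lemma infinite_of_coarse_overlap: "coarse_overlap d A B \<Longrightarrow> infinite A"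
  unfolding coarse_overlap_def using finite_subset by blast

lemma hdist_less_imp_coarse_equal:
  assumes AB: "hdist d A B < ennreal M" and sub: "A \<subseteq> X" "B \<subseteq> X"
  shows "coarse_equal d A B"
proof -
  have "\<exists>a\<in>A. d b a \<le> M" if "b \<in> B" for b
    using hdist_less_imp(2)[OF AB] that sub dist_sym by (metis subsetD)
  then show ?thesis
    unfolding coarse_equal_def coarse_subset_def using hdist_less_imp(1)[OF AB] by blast
qed

end

section \<open>Groups with a left-invariant metric: cosets and conjugates\<close>

locale proper_group_metric = group G + proper_metric "carrier G" d
  for G :: "('a, 'm) monoid_scheme" (structure) and d +
  assumes left_invariant:
    "g \<in> carrier G \<Longrightarrow> x \<in> carrier G \<Longrightarrow> y \<in> carrier G \<Longrightarrow> d (g \<otimes> x) (g \<otimes> y) = d x y"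
begin

lemma dist_one_inv_mult:
  assumes "x \<in> carrier G" "y \<in> carrier G"
  shows "d \<one> (inv x \<otimes> y) = d x y"
  using left_invariant[of "inv x" x y] assms by simp

lemma coarse_subset_l_coset:
  assumes "coarse_subset d A B" "g \<in> carrier G" "A \<subseteq> carrier G" "B \<subseteq> carrier G"
  shows "coarse_subset d (g <# A) (g <# B)"
proof -
  obtain r where r: "\<And>a. a \<in> A \<Longrightarrow> \<exists>b\<in>B. d a b \<le> r" using assms unfolding coarse_subset_def by blast
  have "\<exists>y\<in>g <# B. d x y \<le> r" if x: "x \<in> g <# A" for x
  proof -
    obtain a where "a \<in> A" "x = g \<otimes> a" using x unfolding l_coset_def by blast
    then show ?thesis using r[of a] left_invariant[of g a] assms unfolding l_coset_def
      by (smt (verit) UN_iff singletonI subsetD)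
  qed
  then show ?thesis unfolding coarse_subset_def by blast
qed

lemma coarse_equal_l_coset:
  assumes "coarse_equal d A B" "g \<in> carrier G" "A \<subseteq> carrier G" "B \<subseteq> carrier G"
  shows "coarse_equal d (g <# A) (g <# B)"
  using assms coarse_subset_l_coset unfolding coarse_equal_def by blast

text \<open>By left invariance, right multiplication by \<open>x\<close> moves every point by
  exactly \<open>d \<one> x\<close>.\<close>

lemma coarse_equal_r_coset:
  assumes "A \<subseteq> carrier G" "x \<in> carrier G"
  shows "coarse_equal d A (A #> x)"
proof -
  have *: "d a (a \<otimes> x) \<le> d \<one> x" "d (a \<otimes> x) a \<le> d \<one> x" if "a \<in> A" for a
    using left_invariant[of a \<one> x] that assms dist_sym[of a "a \<otimes> x"] by auto
  show ?thesis
    unfolding coarse_equal_def coarse_subset_def r_coset_def using * by blast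
qed

text \<open>The conjugate is a right translate of the left coset, so coarse statements about
  conjugate subgroups become statements about left cosets.\<close>

lemma coarse_equal_conjugate:
  assumes "P \<subseteq> carrier G" "g \<in> carrier G"
  shows "coarse_equal d (g <# P) (conjugate G g P)"
  unfolding conjugate_def using assms by (intro coarse_equal_r_coset) (auto simp: l_coset_def)

lemma conjugate_eq: "conjugate G g P = (\<lambda>p. g \<otimes> p \<otimes> inv g) ` P"
  unfolding conjugate_def l_coset_def r_coset_def by auto

lemma conjugate_subset: "P \<subseteq> carrier G \<Longrightarrow> g \<in> carrier G \<Longrightarrow> conjugate G g P \<subseteq> carrier G"
  unfolding conjugate_eq by auto

lemma conjugate_one: "P \<subseteq> carrier G \<Longrightarrow> conjugate G \<one> P = P"
  unfolding conjugate_eq by (force simp: subset_iff)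

lemma l_coset_conjugate:
  assumes "P \<subseteq> carrier G" "g \<in> carrier G" "x \<in> carrier G"
  shows "g <# conjugate G x P = (g \<otimes> x) <# P #> inv x"
  using assms unfolding conjugate_def by (simp add: coset_assoc lcos_m_assoc l_coset_subset_G)

lemma coarse_equal_l_coset_conjugate:
  assumes "P \<subseteq> carrier G" "g \<in> carrier G" "x \<in> carrier G"
  shows "coarse_equal d ((g \<otimes> x) <# P) (g <# conjugate G x P)"
  unfolding l_coset_conjugate[OF assms] using assms
  by (intro coarse_equal_r_coset) (auto simp: l_coset_def)

lemma conjugate_conjugate:
  assumes "P \<subseteq> carrier G" "g \<in> carrier G" "h \<in> carrier G"
  shows "conjugate G g (conjugate G h P) = conjugate G (g \<otimes> h) P"
proof -
  have "g \<otimes> (h \<otimes> p \<otimes> inv h) \<otimes> inv g = g \<otimes> h \<otimes> p \<otimes> inv (g \<otimes> h)" if "p \<in> P" for p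
    using assms that by (auto simp: subset_iff m_assoc inv_mult_group)
  then show ?thesis unfolding conjugate_eq image_image by auto
qed

lemma conjugate_inv_conjugate:
  assumes "P \<subseteq> carrier G" "g \<in> carrier G"
  shows "conjugate G (inv g) (conjugate G g P) = P"
  using assms by (simp add: conjugate_conjugate conjugate_one)

lemma subgroup_conjugate:
  assumes "subgroup P G" "g \<in> carrier G"
  shows "subgroup (conjugate G g P) G"
proof
  interpret P: subgroup P G by fact
  show "conjugate G g P \<subseteq> carrier G" using conjugate_subset assms P.subset by blast
  show "\<one> \<in> conjugate G g P" unfolding conjugate_eq
    using assms P.one_closed by (intro image_eqI[of _ _ \<one>]) auto
  fix x assume "x \<in> conjugate G g P"
  then obtain p where p: "p \<in> P" "x = g \<otimes> p \<otimes> inv g" by (auto simp: conjugate_eq)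
  then show "inv x \<in> conjugate G g P" unfolding conjugate_eq
    using assms by (intro image_eqI[of _ _ "inv p"]) (auto simp: inv_mult_group m_assoc)
  fix y assume "y \<in> conjugate G g P"
  then obtain p' where p': "p' \<in> P" "y = g \<otimes> p' \<otimes> inv g" by (auto simp: conjugate_eq)
  have "x \<otimes> y = g \<otimes> p \<otimes> (inv g \<otimes> g) \<otimes> p' \<otimes> inv g"
    using p p' assms by (simp only: m_assoc m_closed inv_closed P.mem_carrier)
  also have "\<dots> = g \<otimes> (p \<otimes> p') \<otimes> inv g" using p p' assms by (simp add: m_assoc)
  finally show "x \<otimes> y \<in> conjugate G g P" unfolding conjugate_eq using p p' by blast
qed

section \<open>Commensurators in coarse terms\<close>

text \<open>If there are finitely many right cosets of the intersection in \<open>P\<close>, the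
  largest norm of a chosen representative bounds the distance to \<open>K\<close>. Conversely, a
  bounded distance to \<open>K\<close> leaves finitely many offsets from \<open>K\<close>, and the
  offset determines the coset.\<close>

lemma finite_index_inter_iff:
  assumes "subgroup P G" "subgroup K G"
  shows "finite_index G (P \<inter> K) P \<longleftrightarrow> coarse_subset d P K"
proof
  interpret P: subgroup P G by fact
  interpret K: subgroup K G by fact
  have rc: "rcosets\<^bsub>G\<lparr>carrier := P\<rparr>\<^esub> (P \<inter> K) = (\<lambda>p. (P \<inter> K) #> p) ` P"
    by (auto simp: RCOSETS_def r_coset_def)
  {
    assume "finite_index G (P \<inter> K) P"
    then have fin: "finite ((\<lambda>p. (P \<inter> K) #> p) ` P)" by (simp add: finite_index_def rc)
    define f where "f C = (SOME x. x \<in> C \<inter> P)" for C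
    have f: "f ((P \<inter> K) #> p) \<in> ((P \<inter> K) #> p) \<inter> P" if "p \<in> P" for p
    proof -
      have "p \<in> ((P \<inter> K) #> p) \<inter> P"
        using that by (force simp: r_coset_def)
      then show ?thesis unfolding f_def by (rule someI)
    qed
    define F where "F = f ` (\<lambda>p. (P \<inter> K) #> p) ` P"
    have "finite F" using fin by (simp add: F_def)
    define r where "r = Max ((\<lambda>x. d x \<one>) ` F)"
    have "\<exists>k\<in>K. d p k \<le> r" if "p \<in> P" for p
    proof -
      define y where "y = f ((P \<inter> K) #> p)"
      have y: "y \<in> P" "y \<in> (P \<inter> K) #> p" "y \<in> F" using f[OF that] that by (auto simp: y_def F_def)
      then obtain k where k: "k \<in> P" "k \<in> K" "y = k \<otimes> p" by (auto simp: r_coset_def)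
      \<comment> \<open>Here \<open>inv k\<close> is the required point of \<open>K\<close>: left
        translation by \<open>k\<close> turns the pair \<open>p\<close>, \<open>inv k\<close> into
        \<open>y\<close>, \<open>\<one>\<close>, and \<open>y\<close> is one of the finitely many
        representatives.\<close>
      then have "p = inv k \<otimes> y" using that by (simp add: inv_solve_left)
      then have "d p (inv k) = d y \<one>" using left_invariant[of "inv k" y \<one>] y k by simp
      also have "\<dots> \<le> r" unfolding r_def using \<open>finite F\<close> y by simp
      finally show ?thesis using k by auto
    qed
    then show "coarse_subset d P K" unfolding coarse_subset_def by blast
  next
    assume "coarse_subset d P K"
    then obtain r where "\<forall>p\<in>P. \<exists>k\<in>K. d p k \<le> r" unfolding coarse_subset_def by blast
    then obtain k where k: "\<And>p. p \<in> P \<Longrightarrow> k p \<in> K \<and> d p (k p) \<le> r" by metis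
    \<comment> \<open>The coset of \<open>p\<close> depends only on \<open>b p\<close>, which ranges over a finite ball.\<close>
    define b where "b p = inv (k p) \<otimes> p" for p
    have "b ` P \<subseteq> {y \<in> carrier G. d \<one> y \<le> r}"
    proof
      fix y assume "y \<in> b ` P"
      then obtain p where p: "p \<in> P" "y = b p" by blast
      have kp: "k p \<in> carrier G" using k p by auto
      have "d \<one> y = d p (k p)"
        using kp p dist_one_inv_mult[OF kp, of p] dist_sym[OF kp, of p] by (simp add: b_def)
      then show "y \<in> {y \<in> carrier G. d \<one> y \<le> r}" using k[OF p(1)] p kp by (simp add: b_def)
    qed
    then have fin: "finite (b ` P)" using finite_ball finite_subset by blast
    \<comment> \<open>With equal offsets, \<open>p' \<otimes> inv p\<close> equals
      \<open>k p' \<otimes> inv (k p)\<close>: the first form lies in \<open>P\<close>, the second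
      in \<open>K\<close>.\<close>
    have eq: "(P \<inter> K) #> p = (P \<inter> K) #> p'" if "p \<in> P" "p' \<in> P" "b p = b p'" for p p'
    proof -
      have c: "k p \<in> K" "k p' \<in> K" using k that by auto
      have "inv (k p) \<otimes> p = inv (k p') \<otimes> p'" using that(3) by (simp add: b_def)
      moreover have "p' = k p' \<otimes> inv (k p') \<otimes> p'" using c that by simp
      ultimately have "p' = k p' \<otimes> inv (k p) \<otimes> p" using c that
        by (simp only: m_assoc inv_closed P.mem_carrier K.mem_carrier)
      moreover from this have "p' \<otimes> inv p = k p' \<otimes> inv (k p)" using c that by (simp add: inv_solve_right')
      then have "k p' \<otimes> inv (k p) \<in> P \<inter> K" using c that by (metis IntI K.m_closed K.m_inv_closed P.m_closed P.m_inv_closed)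
      ultimately have "p' \<in> (P \<inter> K) #> p" by (auto simp: r_coset_def)
      then show ?thesis using that assms by (intro repr_independence subgroups_Inter_pair) auto
    qed
    have "(\<lambda>p. (P \<inter> K) #> p) ` P \<subseteq> (\<lambda>y. (P \<inter> K) #> (SOME p. p \<in> P \<and> b p = y)) ` b ` P"
    proof
      fix C assume "C \<in> (\<lambda>p. (P \<inter> K) #> p) ` P"
      then obtain p where p: "p \<in> P" "C = (P \<inter> K) #> p" by blast
      define p' where "p' = (SOME p'. p' \<in> P \<and> b p' = b p)"
      have "p' \<in> P \<and> b p' = b p" unfolding p'_def by (rule someI[of _ p]) (use p in simp)
      then have "C = (P \<inter> K) #> p'" using eq[of p p'] p by simp
      then show "C \<in> (\<lambda>y. (P \<inter> K) #> (SOME p. p \<in> P \<and> b p = y)) ` b ` P"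
        unfolding p'_def using p by blast
    qed
    then show "finite_index G (P \<inter> K) P"
      unfolding finite_index_def rc using fin finite_subset by blast
  }
qed

text \<open>The two index conditions are the two halves of coarse equality between \<open>P\<close>
  and its conjugate by \<open>g\<close>, and that conjugate is coarsely the coset
  \<open>g <# P\<close>.\<close>

lemma commensurator_iff:
  assumes "subgroup P G"
  shows "g \<in> commensurator G P \<longleftrightarrow> g \<in> carrier G \<and> coarse_equal d (g <# P) P"
proof (cases "g \<in> carrier G")
  case True
  interpret P: subgroup P G by fact
  let ?Q = "conjugate G g P"
  have Q: "subgroup ?Q G" using assms True by (rule subgroup_conjugate)
  then have sub: "?Q \<subseteq> carrier G" "g <# P \<subseteq> carrier G"
    using subgroup.subset True P.subset by (auto simp: l_coset_def)
  have "g \<in> commensurator G P \<longleftrightarrow> coarse_equal d P ?Q"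
    using True finite_index_inter_iff[OF assms Q] finite_index_inter_iff[OF Q assms]
    by (simp add: commensurator_def coarse_equal_def Int_commute)
  also have "\<dots> \<longleftrightarrow> coarse_equal d (g <# P) P"
    using coarse_equal_conjugate[OF P.subset True] coarse_equal_trans coarse_equal_sym sub P.subset
    by meson
  finally show ?thesis using True by simp
qed (simp add: commensurator_def)

lemma subset_commensurator:
  assumes "subgroup P G"
  shows "P \<subseteq> commensurator G P"
proof
  fix p assume p: "p \<in> P"
  have "P \<subseteq> carrier G" using assms subgroup.subset by blast
  then show "p \<in> commensurator G P"
    using assms p coset_join3[OF _ assms p] coarse_equal_refl[of P] by (auto simp: commensurator_iff)
qed

text \<open>Left translation preserves coarse equality, so if \<open>g\<close> commensurates
  \<open>A\<close>, then gB, gA, A and B are successively coarsely equal.\<close>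

lemma commensurator_cong:
  assumes "subgroup P G" "subgroup P' G" "coarse_equal d P P'"
  shows "commensurator G P = commensurator G P'"
proof -
  have "commensurator G A \<subseteq> commensurator G B"
    if A: "subgroup A G" and B: "subgroup B G" and AB: "coarse_equal d A B" for A B
  proof
    fix g assume "g \<in> commensurator G A"
    then have g: "g \<in> carrier G" "coarse_equal d (g <# A) A" by (auto simp: commensurator_iff[OF A])
    have s: "A \<subseteq> carrier G" "B \<subseteq> carrier G" using A B subgroup.subset by auto
    then have s': "g <# A \<subseteq> carrier G" "g <# B \<subseteq> carrier G"
      using g by (simp_all add: l_coset_subset_G)
    have "coarse_equal d (g <# B) (g <# A)"
      using AB g s by (intro coarse_equal_l_coset coarse_equal_sym[OF AB]) auto
    then have "coarse_equal d (g <# B) B"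
      using g(2) AB s s' coarse_equal_trans by meson
    then show "g \<in> commensurator G B" using g by (simp add: commensurator_iff[OF B])
  qed
  then show ?thesis using assms coarse_equal_sym by blast
qed

lemma commensurator_conjugate:
  assumes P: "subgroup P G" and g: "g \<in> carrier G"
  shows "commensurator G (conjugate G g P) = conjugate G g (commensurator G P)"
proof -
  \<comment> \<open>This inclusion is proved for all subgroups and elements; the reverse one is its
    instance for the conjugate subgroup and \<open>inv g\<close>, conjugated back.\<close>
  have *: "conjugate G g (commensurator G P) \<subseteq> commensurator G (conjugate G g P)"
    if P: "subgroup P G" and g: "g \<in> carrier G" for P g
  proof
    fix x assume "x \<in> conjugate G g (commensurator G P)"
    then obtain k where "k \<in> commensurator G P" and x: "x = g \<otimes> k \<otimes> inv g"
      by (auto simp: conjugate_eq)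
    then have k: "k \<in> carrier G" "coarse_equal d (k <# P) P" by (auto simp: commensurator_iff[OF P])
    have s: "P \<subseteq> carrier G" using P subgroup.subset by auto
    \<comment> \<open>Since xg = gk, translating the conjugate of \<open>P\<close> by
      \<open>x\<close> gives a set coarsely equal to gkP, hence to gP, hence to the conjugate
      itself.\<close>
    have xg: "x \<in> carrier G" "x \<otimes> g = g \<otimes> k" using g k x by (auto simp: m_assoc)
    have kP: "coarse_equal d (g <# (k <# P)) (g <# P)"
      using k g s by (intro coarse_equal_l_coset) (auto simp: l_coset_subset_G)
    have 1: "coarse_equal d (x <# conjugate G g P) (g <# (k <# P))"
      using coarse_equal_l_coset_conjugate[OF s xg(1) g] g k s xg
      by (simp add: lcos_m_assoc coarse_equal_sym)
    have "coarse_equal d (x <# conjugate G g P) (g <# P)"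
      by (rule coarse_equal_trans[OF 1 kP]) (use s g k xg in \<open>simp_all add: l_coset_subset_G conjugate_subset\<close>)
    then have "coarse_equal d (x <# conjugate G g P) (conjugate G g P)"
      using coarse_equal_conjugate[OF s g]
      by (rule coarse_equal_trans) (use s g xg in \<open>simp_all add: l_coset_subset_G conjugate_subset\<close>)
    then show "x \<in> commensurator G (conjugate G g P)"
      using xg by (simp add: commensurator_iff[OF subgroup_conjugate[OF P g]])
  qed
  let ?Q = "conjugate G g P"
  have sQ: "subgroup ?Q G" and s: "P \<subseteq> carrier G"
    and sc: "commensurator G ?Q \<subseteq> carrier G"
    using P g subgroup_conjugate subgroup.subset[OF P] by (simp_all add: commensurator_def)
  have "conjugate G (inv g) (commensurator G ?Q) \<subseteq> commensurator G P"
    using *[OF sQ, of "inv g"] g s by (simp add: conjugate_inv_conjugate)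
  then have "conjugate G g (conjugate G (inv g) (commensurator G ?Q)) \<subseteq> conjugate G g (commensurator G P)"
    unfolding conjugate_eq by blast
  then have "commensurator G ?Q \<subseteq> conjugate G g (commensurator G P)"
    using sc g by (simp add: conjugate_conjugate conjugate_one)
  then show ?thesis using *[OF P g] by blast
qed

section \<open>Rigidity of cosets of an almost malnormal collection\<close>

lemma left_cosets_of_subset:
  assumes "\<And>Q. Q \<in> \<Q> \<Longrightarrow> subgroup Q G" "A \<in> left_cosets_of G \<Q>"
  shows "A \<subseteq> carrier G"
  using assms subgroup.lcosets_carrier is_group unfolding left_cosets_of_def by blast

lemma left_cosets_of_eq:
  "left_cosets_of G \<Q> = {g <# Q | g Q. g \<in> carrier G \<and> Q \<in> \<Q>}"
  unfolding left_cosets_of_def LCOSETS_def by blast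

text \<open>Infinitely many points of gQ share one offset from hK. Their quotients by a fixed such
  point, conjugated by \<open>inv h\<close>, are infinitely many elements common to \<open>K\<close>
  and the conjugate of \<open>Q\<close> by \<open>x\<close>, where x is h^-1 g. Almost malnormality
  then gives Q = K and puts \<open>x\<close> in \<open>Q\<close>.\<close>

lemma almost_malnormal_coarse_overlap:
  assumes mal: "almost_malnormal G \<Q>" and sg: "\<And>Q. Q \<in> \<Q> \<Longrightarrow> subgroup Q G"
    and A: "A \<in> left_cosets_of G \<Q>" and B: "B \<in> left_cosets_of G \<Q>"
    and AB: "coarse_overlap d A B"
  shows "A = B"
proof -
  obtain g Q where Q: "Q \<in> \<Q>" "g \<in> carrier G" "A = g <# Q" using A by (auto simp: left_cosets_of_eq)
  obtain h K where K: "K \<in> \<Q>" "h \<in> carrier G" "B = h <# K" using B by (auto simp: left_cosets_of_eq)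
  interpret Q: subgroup Q G using sg Q by blast
  interpret K: subgroup K G using sg K by blast
  obtain I where I: "I \<subseteq> A" "infinite I" "coarse_subset d I B"
    using AB unfolding coarse_overlap_def by blast
  then obtain r where "\<forall>a\<in>I. \<exists>b\<in>B. d a b \<le> r" unfolding coarse_subset_def by blast
  then obtain f where f: "\<And>a. a \<in> I \<Longrightarrow> f a \<in> B \<and> d a (f a) \<le> r" by metis
  have s: "A \<subseteq> carrier G" "B \<subseteq> carrier G" 
    using Q K Q.subset K.subset by (simp_all add: l_coset_subset_G)
  \<comment> \<open>If \<open>a\<close> and \<open>a0\<close> have the same offset \<open>e\<close> from \<open>B\<close>, then \<open>a \<otimes> inv a0\<close> lies both in
    \<open>g Q g\<inverse>\<close> and in \<open>h K h\<inverse>\<close>.\<close>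
  define e where "e a = inv (f a) \<otimes> a" for a
  have "e ` I \<subseteq> {y \<in> carrier G. d \<one> y \<le> r}"
  proof
    fix y assume "y \<in> e ` I"
    then obtain a where a: "a \<in> I" "y = e a" by blast
    have c: "a \<in> carrier G" "f a \<in> carrier G" "d a (f a) \<le> r" using a f I s by blast+
    have "d \<one> y = d a (f a)"
      using c a dist_one_inv_mult[of "f a" a] dist_sym[of a "f a"] by (simp add: e_def)
    then show "y \<in> {y \<in> carrier G. d \<one> y \<le> r}" using a c by (simp add: e_def)
  qed
  then have "finite (e ` I)" using finite_ball finite_subset by blast
  then obtain a0 where a0: "a0 \<in> I" and inf: "infinite {a \<in> I. e a = e a0}"
    using pigeonhole_infinite[OF I(2)] by blast
  define J where "J = {a \<in> I. e a = e a0}"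
  define x where "x = inv h \<otimes> g"
  have x: "x \<in> carrier G" using Q K by (simp add: x_def)
  \<comment> \<open>Conjugating by \<open>inv h\<close> turns the conjugate of \<open>K\<close> into
    \<open>K\<close> itself, the form in which \<open>almost_malnormal\<close> is stated.\<close>
  define w where "w a = inv h \<otimes> (a \<otimes> inv a0) \<otimes> h" for a
  have ac: "a \<in> carrier G" if "a \<in> I" for a using that I s by auto
  have "inj_on w J"
  proof
    fix a b assume "a \<in> J" "b \<in> J" "w a = w b"
    moreover from this have "a \<in> carrier G" "b \<in> carrier G" using ac by (auto simp: J_def)
    ultimately show "a = b" using ac[OF a0] K unfolding w_def
      by (metis Units_eq Units_l_cancel inv_closed m_closed right_cancel)
  qed
  then have "infinite (w ` J)" using inf finite_imageD unfolding J_def by blast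
  moreover have "w ` J \<subseteq> conjugate G x Q \<inter> K"
  proof clarify
    fix a assume "a \<in> J"
    then have a: "a \<in> I" "e a = e a0" by (auto simp: J_def)
    obtain u u0 where u: "u \<in> Q" "u0 \<in> Q" "a = g \<otimes> u" "a0 = g \<otimes> u0"
      using a a0 I Q unfolding l_coset_def by blast
    obtain v v0 where v: "v \<in> K" "v0 \<in> K" "f a = h \<otimes> v" "f a0 = h \<otimes> v0"
      using f[OF a(1)] f[OF a0] K unfolding l_coset_def by blast
    have c: "a \<in> carrier G" "a0 \<in> carrier G" "f a \<in> carrier G" "f a0 \<in> carrier G"
      using ac a(1) a0 f s by blast+
    then have eq: "e a \<in> carrier G" "a = f a \<otimes> e a" "a0 = f a0 \<otimes> e a0"
      by (simp_all add: e_def m_assoc[symmetric])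
    have "w a = x \<otimes> (u \<otimes> inv u0) \<otimes> inv x"
      using u Q K by (simp add: w_def x_def inv_mult_group m_assoc)
    then have "w a \<in> conjugate G x Q" using u unfolding conjugate_eq by blast
    moreover have "a \<otimes> inv a0 = h \<otimes> v \<otimes> inv v0 \<otimes> inv h"
    proof -
      \<comment> \<open>The common offset cancels between the two factors.\<close>
      have "a \<otimes> inv a0 = (h \<otimes> v \<otimes> e a) \<otimes> inv (h \<otimes> v0 \<otimes> e a)"
        using eq(2,3) v(3,4) a(2) by metis
      also have "\<dots> = h \<otimes> v \<otimes> (e a \<otimes> inv (e a)) \<otimes> inv v0 \<otimes> inv h"
        using eq(1) v(1,2) K(2)
          by (simp only: inv_mult_group m_assoc m_closed inv_closed K.mem_carrier)
      finally show ?thesis using eq(1) v(1,2) K(2) by simp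
    qed
    then have "w a = inv h \<otimes> h \<otimes> v \<otimes> inv v0 \<otimes> (inv h \<otimes> h)"
      unfolding w_def using K v(1,2)
      by (simp only: m_assoc m_closed inv_closed K.mem_carrier)
    then have "w a \<in> K" using K v(1,2) by simp
    ultimately show "w a \<in> conjugate G x Q \<inter> K" by blast
  qed
  ultimately have "infinite (conjugate G x Q \<inter> K)" using finite_subset by blast
  then have QK: "Q = K" "x \<in> Q" using mal Q K x unfolding almost_malnormal_def by blast+
  have "A = h <# (x <# Q)"
    using Q K x Q.subset by (simp add: lcos_m_assoc x_def m_assoc[symmetric])
  also have "x <# Q = Q" using x QK Q.subgroup_axioms coset_join3 by blast
  finally show ?thesis using QK K by simp
qed

end


section \<open>Quasi-isometries preserve and reflect coarse relations\<close>

lemma quasi_isometry_coarse_subset_iff: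
  assumes q: "quasi_isometry L C X dX Y dY q" and sub: "A \<subseteq> X" "B \<subseteq> X"
  shows "coarse_subset dY (q ` A) (q ` B) \<longleftrightarrow> coarse_subset dX A B"
proof
  have L: "L \<ge> 1" using q by (simp add: quasi_isometry_def)
  \<comment> \<open>The lower quasi-isometry bound is solved for the distance in \<open>X\<close>,
    so that each direction of the equivalence uses one upper bound.\<close>
  have le: "dY (q x) (q y) \<le> L * dX x y + C" "dX x y \<le> L * (dY (q x) (q y) + C)"
    if "x \<in> X" "y \<in> X" for x y
  proof -
    show "dY (q x) (q y) \<le> L * dX x y + C" using q that by (simp add: quasi_isometry_def)
    have "dX x y / L \<le> dY (q x) (q y) + C" using q that by (force simp: quasi_isometry_def)
    then show "dX x y \<le> L * (dY (q x) (q y) + C)" using L by (simp add: field_simps)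
  qed
  {
    assume "coarse_subset dY (q ` A) (q ` B)"
    then obtain r where r: "\<forall>a\<in>A. \<exists>b\<in>B. dY (q a) (q b) \<le> r"
      unfolding coarse_subset_def by blast
    have "\<forall>a\<in>A. \<exists>b\<in>B. dX a b \<le> L * (r + C)"
    proof
      fix a assume a: "a \<in> A"
      then obtain b where b: "b \<in> B" "dY (q a) (q b) \<le> r" using r by blast
      have "dX a b \<le> L * (dY (q a) (q b) + C)" using le a b sub by blast
      also have "\<dots> \<le> L * (r + C)" using b L by (intro mult_left_mono) auto
      finally show "\<exists>b\<in>B. dX a b \<le> L * (r + C)" using b by blast
    qed
    then show "coarse_subset dX A B" unfolding coarse_subset_def by blast
  next
    assume "coarse_subset dX A B"
    then obtain r where r: "\<forall>a\<in>A. \<exists>b\<in>B. dX a b \<le> r"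
      unfolding coarse_subset_def by blast
    have "\<forall>a\<in>A. \<exists>b\<in>B. dY (q a) (q b) \<le> L * r + C"
    proof
      fix a assume a: "a \<in> A"
      then obtain b where b: "b \<in> B" "dX a b \<le> r" using r by blast
      have "dY (q a) (q b) \<le> L * dX a b + C" using le a b sub by blast
      also have "\<dots> \<le> L * r + C" using b L by simp
      finally show "\<exists>b\<in>B. dY (q a) (q b) \<le> L * r + C" using b by blast
    qed
    then show "coarse_subset dY (q ` A) (q ` B)" unfolding coarse_subset_def by blast
  }
qed

lemma quasi_isometry_coarse_equal_iff:
  assumes "quasi_isometry L C X dX Y dY q" "A \<subseteq> X" "B \<subseteq> X"
  shows "coarse_equal dY (q ` A) (q ` B) \<longleftrightarrow> coarse_equal dX A B"
  using assms quasi_isometry_coarse_subset_iff unfolding coarse_equal_def by metis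

text \<open>A quasi-isometry need not be injective, but points with the same image are within
  \<open>L * C\<close> of each other, so fibres are bounded.\<close>

lemma quasi_isometry_infinite_image:
  assumes q: "quasi_isometry L C X dX Y dY q" and "proper_metric X dX" "proper_metric Y dY"
    and I: "I \<subseteq> X" "infinite I"
  shows "infinite (q ` I)"
proof -
  interpret X: proper_metric X dX by fact
  interpret Y: proper_metric Y dY by fact
  show ?thesis
  proof (rule X.infinite_image_bounded_fibres[where r = "L * C"])
    fix a b assume "a \<in> I" "b \<in> I" "q a = q b"
    moreover from this have "a \<in> X" "b \<in> X" using I by auto
    then have "dX a b / L - C \<le> dY (q a) (q b)" "q a \<in> Y" "L \<ge> 1"
      using q by (auto simp: quasi_isometry_def)
    ultimately show "dX a b \<le> L * C" using Y.dist_self by (simp add: field_simps)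
  qed (use I in auto)
qed

lemma quasi_isometry_coarse_overlap:
  assumes q: "quasi_isometry L C X dX Y dY q" and "proper_metric X dX" "proper_metric Y dY"
    and sub: "A \<subseteq> X" "B \<subseteq> X" and AB: "coarse_overlap dX A B"
  shows "coarse_overlap dY (q ` A) (q ` B)"
proof -
  obtain I where I: "I \<subseteq> A" "infinite I" "coarse_subset dX I B"
    using AB unfolding coarse_overlap_def by blast
  then have "I \<subseteq> X" using sub by blast
  then have "infinite (q ` I)" "coarse_subset dY (q ` I) (q ` B)"
    using quasi_isometry_infinite_image[OF assms(1-3)] quasi_isometry_coarse_subset_iff[OF q] I sub
    by auto
  then show ?thesis unfolding coarse_overlap_def using I by blast
qed

section \<open>Word metrics of finitely generated groups\<close>

context group
begin

lemma foldr_mult_closed: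
  "set ws \<subseteq> carrier G \<Longrightarrow> foldr (\<otimes>) ws \<one> \<in> carrier G"
  by (induction ws) auto

lemma foldr_mult_append:
  "set vs \<subseteq> carrier G \<Longrightarrow> set ws \<subseteq> carrier G \<Longrightarrow>
    foldr (\<otimes>) (vs @ ws) \<one> = foldr (\<otimes>) vs \<one> \<otimes> foldr (\<otimes>) ws \<one>"
  by (induction vs) (use foldr_mult_closed in \<open>auto simp: m_assoc\<close>)

lemma foldr_mult_inv:
  "set ws \<subseteq> carrier G \<Longrightarrow>
    foldr (\<otimes>) (rev (map (\<lambda>x. inv x) ws)) \<one> = inv (foldr (\<otimes>) ws \<one>)"
proof (induction ws)
  case (Cons w ws)
  have "foldr (\<otimes>) (rev (map (\<lambda>x. inv x) ws) @ [inv w]) \<one>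
      = foldr (\<otimes>) (rev (map (\<lambda>x. inv x) ws)) \<one> \<otimes> foldr (\<otimes>) [inv w] \<one>"
    using Cons.prems by (intro foldr_mult_append) auto
  then show ?case using Cons foldr_mult_closed by (simp add: inv_mult_group)
qed simp

end

locale finitely_generated_group = group G for G :: "('a, 'm) monoid_scheme" (structure) +
  fixes S :: "'a set"
  assumes finite_generating_set: "finite_generating_set G S"
begin

definition letters :: "'a set" where
  "letters = S \<union> (\<lambda>s. inv s) ` S"

lemma finite_letters: "finite letters"
  and letters_subset: "letters \<subseteq> carrier G"
  and inv_letters: "x \<in> letters \<Longrightarrow> inv x \<in> letters"
  using finite_generating_set by (auto simp: finite_generating_set_def letters_def subset_iff)

lemma word_exists:
  assumes "g \<in> carrier G"
  obtains ws where "set ws \<subseteq> letters" "foldr (\<otimes>) ws \<one> = g"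
proof -
  have "g \<in> generate G S" using assms finite_generating_set by (simp add: finite_generating_set_def)
  then have "\<exists>ws. set ws \<subseteq> letters \<and> foldr (\<otimes>) ws \<one> = g"
  proof induction
    case one
    show ?case by (intro exI[of _ "[]"]) simp
  next
    case (incl h)
    then have "h \<in> letters" by (simp add: letters_def)
    then show ?case using letters_subset by (intro exI[of _ "[h]"]) auto
  next
    case (inv h)
    then have "inv h \<in> letters" by (simp add: letters_def)
    then show ?case using letters_subset by (intro exI[of _ "[inv h]"]) auto
  next
    case (eng h1 h2)
    then obtain vs ws where "set vs \<subseteq> letters" "foldr (\<otimes>) vs \<one> = h1"
      "set ws \<subseteq> letters" "foldr (\<otimes>) ws \<one> = h2" by blast
    then show ?case using letters_subset foldr_mult_append[of vs ws]
      by (intro exI[of _ "vs @ ws"]) auto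
  qed
  then show ?thesis using that by blast
qed

lemma word_length_le:
  "set ws \<subseteq> letters \<Longrightarrow> word_length G S (foldr (\<otimes>) ws \<one>) \<le> length ws"
  unfolding word_length_def letters_def by (rule Least_le) blast

lemma shortest_word:
  assumes "g \<in> carrier G"
  obtains ws where "set ws \<subseteq> letters" "foldr (\<otimes>) ws \<one> = g" "length ws = word_length G S g"
proof -
  obtain ws where "set ws \<subseteq> letters" "foldr (\<otimes>) ws \<one> = g" using word_exists assms by blast
  then have "\<exists>n ws. set ws \<subseteq> S \<union> (\<lambda>s. inv s) ` S \<and> length ws = n \<and> foldr (\<otimes>) ws \<one> = g"
    unfolding letters_def by blast
  then have "\<exists>ws. set ws \<subseteq> S \<union> (\<lambda>s. inv s) ` S \<and> length ws = word_length G S g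
      \<and> foldr (\<otimes>) ws \<one> = g"
    unfolding word_length_def by (rule LeastI_ex)
  then show ?thesis using that by (auto simp: letters_def)
qed

lemma word_length_one: "word_length G S \<one> = 0"
  using word_length_le[of "[]"] by simp

lemma word_length_inv_le:
  assumes "g \<in> carrier G"
  shows "word_length G S (inv g) \<le> word_length G S g"
proof -
  obtain ws where ws: "set ws \<subseteq> letters" "foldr (\<otimes>) ws \<one> = g" "length ws = word_length G S g"
    using shortest_word assms by blast
  have "set (rev (map (\<lambda>x. inv x) ws)) \<subseteq> letters" using ws inv_letters by auto
  from word_length_le[OF this] show ?thesis
    using ws letters_subset foldr_mult_inv[of ws] by simp
qed

lemma word_length_inv: "g \<in> carrier G \<Longrightarrow> word_length G S (inv g) = word_length G S g"
  using word_length_inv_le[of g] word_length_inv_le[of "inv g"] by simp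

lemma word_length_mult_le:
  assumes "g \<in> carrier G" "h \<in> carrier G"
  shows "word_length G S (g \<otimes> h) \<le> word_length G S g + word_length G S h"
proof -
  obtain vs ws where "set vs \<subseteq> letters" "foldr (\<otimes>) vs \<one> = g" "length vs = word_length G S g"
    and "set ws \<subseteq> letters" "foldr (\<otimes>) ws \<one> = h" "length ws = word_length G S h"
    using shortest_word assms by metis
  then show ?thesis
    using word_length_le[of "vs @ ws"] foldr_mult_append[of vs ws] letters_subset by auto
qed

lemma finite_word_length_le: "finite {g \<in> carrier G. word_length G S g \<le> n}"
proof (rule finite_subset)
  \<comment> \<open>Each such element is spelled by a shortest word, and a finite alphabet has
    finitely many words of bounded length.\<close>
  show "{g \<in> carrier G. word_length G S g \<le> n}
      \<subseteq> (\<lambda>ws. foldr (\<otimes>) ws \<one>) ` {ws. set ws \<subseteq> letters \<and> length ws \<le> n}"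
  proof clarify
    fix g assume "g \<in> carrier G" "word_length G S g \<le> n"
    then show "g \<in> (\<lambda>ws. foldr (\<otimes>) ws \<one>) ` {ws. set ws \<subseteq> letters \<and> length ws \<le> n}"
      by (metis (mono_tags, lifting) shortest_word image_eqI mem_Collect_eq)
  qed
  show "finite ((\<lambda>ws. foldr (\<otimes>) ws \<one>) ` {ws. set ws \<subseteq> letters \<and> length ws \<le> n})"
    using finite_lists_length_le[OF finite_letters] by blast
qed

sublocale proper_group_metric G "word_dist G S"
proof
  fix x y z g r
  show "0 \<le> word_dist G S x y" by (simp add: word_dist_def)
  show "word_dist G S x x = 0" if "x \<in> carrier G"
    using that by (simp add: word_dist_def word_length_one)
  show "word_dist G S x y = word_dist G S y x" if "x \<in> carrier G" "y \<in> carrier G"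
    using that word_length_inv[of "inv x \<otimes> y"] by (simp add: word_dist_def inv_mult_group)
  show "word_dist G S x z \<le> word_dist G S x y + word_dist G S y z"
    if "x \<in> carrier G" "y \<in> carrier G" "z \<in> carrier G"
  proof -
    have "y \<otimes> (inv y \<otimes> z) = z" using that by (simp flip: m_assoc)
    then have "(inv x \<otimes> y) \<otimes> (inv y \<otimes> z) = inv x \<otimes> z"
      using that by (simp add: m_assoc)
    then show ?thesis using word_length_mult_le[of "inv x \<otimes> y" "inv y \<otimes> z"] that
      by (simp add: word_dist_def flip: of_nat_add)
  qed
  show "word_dist G S (g \<otimes> x) (g \<otimes> y) = word_dist G S x y"
    if "g \<in> carrier G" "x \<in> carrier G" "y \<in> carrier G"
  proof -
    have "inv g \<otimes> (g \<otimes> y) = y" using that by (simp flip: m_assoc)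
    then have "inv (g \<otimes> x) \<otimes> (g \<otimes> y) = inv x \<otimes> y"
      using that by (simp add: inv_mult_group m_assoc)
    then show ?thesis by (simp add: word_dist_def)
  qed
  show "finite {y \<in> carrier G. word_dist G S x y \<le> r}" if x: "x \<in> carrier G"
  proof (rule finite_subset)
    \<comment> \<open>The ball about \<open>x\<close> lies in a translate of one about the identity;
      word lengths are natural numbers, so the real radius may be rounded down.\<close>
    show "{y \<in> carrier G. word_dist G S x y \<le> r}
        \<subseteq> (\<lambda>g. x \<otimes> g) ` {g \<in> carrier G. word_length G S g \<le> nat \<lfloor>r\<rfloor>}"
    proof clarify
      fix y assume y: "y \<in> carrier G" "word_dist G S x y \<le> r"
      then have "word_length G S (inv x \<otimes> y) \<le> nat \<lfloor>r\<rfloor>" by (simp add: word_dist_def le_nat_floor)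
      moreover have "y = x \<otimes> (inv x \<otimes> y)" using x y by (simp flip: m_assoc)
      ultimately show "y \<in> (\<lambda>g. x \<otimes> g) ` {g \<in> carrier G. word_length G S g \<le> nat \<lfloor>r\<rfloor>}"
        using x y by blast
    qed
  qed (use finite_word_length_le in blast)
qed

end


section \<open>Partner cosets under a quasi-isometry of pairs\<close>

locale quasi_isometry_of_pairs_almost_malnormal =
  G: finitely_generated_group G S + H: finitely_generated_group H T
  for G :: "('a, 'm) monoid_scheme" and S and H :: "('b, 'n) monoid_scheme" and T +
  fixes \<P> \<Q> q L C M
  assumes subgroup_G: "P \<in> \<P> \<Longrightarrow> subgroup P G"
    and subgroup_H: "Q \<in> \<Q> \<Longrightarrow> subgroup Q H"
    and pairs: "quasi_isometry_of_pairs_with L C M G S \<P> H T \<Q> q"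
    and malnormal: "almost_malnormal H \<Q>"
    and infinite_H: "Q \<in> \<Q> \<Longrightarrow> infinite Q"
begin

abbreviation "d\<^sub>G \<equiv> word_dist G S"
abbreviation "d\<^sub>H \<equiv> word_dist H T"

lemma qi: "quasi_isometry L C (carrier G) d\<^sub>G (carrier H) d\<^sub>H q"
  and M_nonneg: "0 \<le> M" and L_ge_one: "1 \<le> L" and C_nonneg: "0 \<le> C"
  using pairs by (auto simp: quasi_isometry_of_pairs_with_def quasi_isometry_def)

lemma q_closed: "x \<in> carrier G \<Longrightarrow> q x \<in> carrier H"
  and q_upper: "x \<in> carrier G \<Longrightarrow> y \<in> carrier G \<Longrightarrow> d\<^sub>H (q x) (q y) \<le> L * d\<^sub>G x y + C"
  using qi by (auto simp: quasi_isometry_def)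

lemma image_subset: "A \<subseteq> carrier G \<Longrightarrow> q ` A \<subseteq> carrier H"
  using q_closed by blast

lemma coset_partner:
  assumes "A \<in> left_cosets_of G \<P>"
  obtains B where "B \<in> left_cosets_of H \<Q>" "hdist d\<^sub>H (q ` A) B < ennreal M"
proof -
  have "A \<in> fst ` coset_relation G \<P> H T \<Q> M q"
    using assms pairs by (simp add: quasi_isometry_of_pairs_with_def)
  then show ?thesis using that by (auto simp: coset_relation_def)
qed

lemma coset_partner':
  assumes "B \<in> left_cosets_of H \<Q>"
  obtains A where "A \<in> left_cosets_of G \<P>" "hdist d\<^sub>H (q ` A) B < ennreal M"
proof -
  have "B \<in> snd ` coset_relation G \<P> H T \<Q> M q"
    using assms pairs by (simp add: quasi_isometry_of_pairs_with_def)
  then show ?thesis using that by (auto simp: coset_relation_def)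
qed

lemma coset_subset_G: "A \<in> left_cosets_of G \<P> \<Longrightarrow> A \<subseteq> carrier G"
  using G.left_cosets_of_subset subgroup_G by blast

lemma coset_subset_H: "B \<in> left_cosets_of H \<Q> \<Longrightarrow> B \<subseteq> carrier H"
  using H.left_cosets_of_subset subgroup_H by blast

lemma coset_in_G: "P \<in> \<P> \<Longrightarrow> g \<in> carrier G \<Longrightarrow> g <#\<^bsub>G\<^esub> P \<in> left_cosets_of G \<P>"
  using G.left_cosets_of_eq by blast

lemma infinite_coset_H:
  assumes "B \<in> left_cosets_of H \<Q>"
  shows "infinite B"
proof -
  obtain h Q where Q: "Q \<in> \<Q>" "h \<in> carrier H" "B = h <#\<^bsub>H\<^esub> Q"
    using assms by (auto simp: H.left_cosets_of_eq)
  have "inj_on (\<lambda>x. h \<otimes>\<^bsub>H\<^esub> x) Q"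
    using Q subgroup.subset[OF subgroup_H[OF Q(1)]] by (intro inj_onI) (auto simp: subset_iff)
  moreover have "B = (\<lambda>x. h \<otimes>\<^bsub>H\<^esub> x) ` Q" using Q by (auto simp: l_coset_def)
  ultimately show ?thesis using infinite_H Q finite_imageD by blast
qed

lemma partner_coarse_equal:
  assumes "A \<in> left_cosets_of G \<P>" "B \<in> left_cosets_of H \<Q>" "hdist d\<^sub>H (q ` A) B < ennreal M"
  shows "coarse_equal d\<^sub>H (q ` A) B"
  by (rule H.hdist_less_imp_coarse_equal[OF assms(3) image_subset[OF coset_subset_G[OF assms(1)]]
        coset_subset_H[OF assms(2)]])

text \<open>The overlap passes through \<open>q\<close> to the images and from there to the
  partners, where rigidity of cosets in \<open>H\<close> applies.\<close>

lemma partner_eq_of_coarse_overlap: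
  assumes A: "A \<in> left_cosets_of G \<P>" "B \<in> left_cosets_of H \<Q>" "hdist d\<^sub>H (q ` A) B < ennreal M"
    and A': "A' \<in> left_cosets_of G \<P>" "B' \<in> left_cosets_of H \<Q>" "hdist d\<^sub>H (q ` A') B' < ennreal M"
    and AA': "coarse_overlap d\<^sub>G A A'"
  shows "B = B'"
proof -
  note sub = coset_subset_G[OF A(1)] coset_subset_G[OF A'(1)]
  have "coarse_overlap d\<^sub>H (q ` A) (q ` A')"
    by (rule quasi_isometry_coarse_overlap[OF qi G.proper_metric_axioms H.proper_metric_axioms sub AA'])
  moreover have "coarse_subset d\<^sub>H (q ` A) B" "coarse_subset d\<^sub>H (q ` A') B'"
    using partner_coarse_equal[OF A] partner_coarse_equal[OF A'] by (simp_all add: coarse_equal_def)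
  ultimately have "coarse_overlap d\<^sub>H B B'"
    using image_subset[OF sub(1)] coset_subset_H[OF A(2)] image_subset[OF sub(2)] coset_subset_H[OF A'(2)]
    by (rule H.coarse_overlap_trans)
  then show ?thesis
    using H.almost_malnormal_coarse_overlap[OF malnormal] subgroup_H A A' by blast
qed

text \<open>Infinitude is assumed only in \<open>H\<close> and is pulled back: the partner overlaps
  itself, hence so does the image of \<open>A\<close>, which is therefore infinite.\<close>

lemma infinite_coset_G:
  assumes "A \<in> left_cosets_of G \<P>"
  shows "infinite A"
proof -
  obtain B where B: "B \<in> left_cosets_of H \<Q>" "hdist d\<^sub>H (q ` A) B < ennreal M"
    using coset_partner assms by blast
  have BA: "coarse_subset d\<^sub>H B (q ` A)"
    using partner_coarse_equal[OF assms B] by (simp add: coarse_equal_def)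
  note sub = coset_subset_H[OF B(1)] image_subset[OF coset_subset_G[OF assms]]
  have "coarse_overlap d\<^sub>H B B"
    using sub(1) infinite_coset_H[OF B(1)] by (rule H.coarse_overlap_refl)
  then have "coarse_overlap d\<^sub>H (q ` A) (q ` A)"
    using BA BA sub sub by (rule H.coarse_overlap_trans)
  then show ?thesis using H.infinite_of_coarse_overlap by blast
qed

text \<open>Infinite sets that are coarsely equal overlap coarsely.\<close>

lemma partner_eq_of_coarse_equal:
  assumes "A \<in> left_cosets_of G \<P>" "B \<in> left_cosets_of H \<Q>" "hdist d\<^sub>H (q ` A) B < ennreal M"
    and "A' \<in> left_cosets_of G \<P>" "B' \<in> left_cosets_of H \<Q>" "hdist d\<^sub>H (q ` A') B' < ennreal M"
    and "coarse_equal d\<^sub>G A A'"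
  shows "B = B'"
proof (rule partner_eq_of_coarse_overlap[OF assms(1-6)])
  note sub = coset_subset_G[OF assms(1)] coset_subset_G[OF assms(4)]
  have "coarse_overlap d\<^sub>G A A"
    using sub(1) infinite_coset_G[OF assms(1)] by (rule G.coarse_overlap_refl)
  moreover have "coarse_subset d\<^sub>G A A'" using assms(7) by (simp add: coarse_equal_def)
  ultimately show "coarse_overlap d\<^sub>G A A'"
    using G.coarse_subset_refl[OF sub(1)] G.coarse_overlap_trans[of A A A A'] sub by simp
qed

text \<open>Both images are coarsely equal to \<open>B\<close>, and \<open>q\<close> reflects coarse
  equality.\<close>

lemma coarse_equal_of_partner_eq:
  assumes "A \<in> left_cosets_of G \<P>" "hdist d\<^sub>H (q ` A) B < ennreal M"
    and "A' \<in> left_cosets_of G \<P>" "hdist d\<^sub>H (q ` A') B < ennreal M"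
    and "B \<in> left_cosets_of H \<Q>"
  shows "coarse_equal d\<^sub>G A A'"
proof -
  note sub = coset_subset_G[OF assms(1)] coset_subset_G[OF assms(3)]
  have "coarse_equal d\<^sub>H (q ` A) (q ` A')"
    using partner_coarse_equal[OF assms(1,5,2)] coarse_equal_sym[OF partner_coarse_equal[OF assms(3,5,4)]]
      image_subset[OF sub(1)] coset_subset_H[OF assms(5)] image_subset[OF sub(2)]
    by (rule H.coarse_equal_trans)
  then show ?thesis using quasi_isometry_coarse_equal_iff[OF qi sub] by blast
qed

section \<open>Cosets of commensurators lie uniformly near partner cosets\<close>

text \<open>The distance between kP and P is not uniform over commensurating elements k, so coarse
  equality alone gives no common bound. Sharing the partner \<open>B\<close> does: every coset
  involved has its image within the same \<open>M\<close> of \<open>B\<close>. The rest of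
  \<open>r\<close> pays for moving from a point a to ax, which lies in a coset of
  \<open>P\<close>.\<close>

lemma commensurator_coset_near_partner:
  assumes P: "P \<in> \<P>" and g: "g \<in> carrier G" and x: "x \<in> carrier G"
    and B: "B \<in> left_cosets_of H \<Q>" and AB: "hdist d\<^sub>H (q ` ((g \<otimes>\<^bsub>G\<^esub> x) <#\<^bsub>G\<^esub> P)) B < ennreal M"
  defines "A \<equiv> g <#\<^bsub>G\<^esub> commensurator G (conjugate G x P)"
    and "r \<equiv> M + (L * d\<^sub>G \<one>\<^bsub>G\<^esub> x + C)"
  shows "\<forall>a\<in>q ` A. \<exists>b\<in>B. d\<^sub>H a b \<le> r" and "\<forall>b\<in>B. \<exists>a\<in>q ` A. d\<^sub>H a b \<le> r"
proof -
  interpret P: subgroup P G using subgroup_G P .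
  let ?P = "conjugate G x P"
  have sP: "subgroup ?P G" using G.subgroup_conjugate P.subgroup_axioms x .
  have sub: "?P \<subseteq> carrier G" using sP subgroup.subset by blast
  have shift: "d\<^sub>G a (a \<otimes>\<^bsub>G\<^esub> x) = d\<^sub>G \<one>\<^bsub>G\<^esub> x" if "a \<in> carrier G" for a
    using G.left_invariant[of a "\<one>\<^bsub>G\<^esub>" x] that x by simp
  have close: "d\<^sub>H (q a) b \<le> r"
    if "a \<in> carrier G" "b \<in> carrier H" "d\<^sub>H (q (a \<otimes>\<^bsub>G\<^esub> x)) b \<le> M" for a b
  proof -
    have "d\<^sub>H (q a) b \<le> d\<^sub>H (q a) (q (a \<otimes>\<^bsub>G\<^esub> x)) + d\<^sub>H (q (a \<otimes>\<^bsub>G\<^esub> x)) b"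
      using that x q_closed by (intro H.triangle) auto
    also have "\<dots> \<le> (L * d\<^sub>G a (a \<otimes>\<^bsub>G\<^esub> x) + C) + M"
      using that x q_upper[of a "a \<otimes>\<^bsub>G\<^esub> x"] by (intro add_mono) auto
    finally show "d\<^sub>H (q a) b \<le> r" using shift[OF that(1)] by (simp add: r_def)
  qed
  have "\<exists>b\<in>B. d\<^sub>H (q a) b \<le> r" if "a \<in> A" for a
  proof -
    obtain k where k': "k \<in> commensurator G ?P" and a: "a = g \<otimes>\<^bsub>G\<^esub> k"
      using \<open>a \<in> A\<close> unfolding A_def l_coset_def by blast
    then have k: "k \<in> carrier G" "coarse_equal d\<^sub>G (k <#\<^bsub>G\<^esub> ?P) ?P"
      by (auto simp: G.commensurator_iff[OF sP])
    have ac: "a \<in> carrier G" using a g k by simp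
    have "coarse_equal d\<^sub>G (g <#\<^bsub>G\<^esub> (k <#\<^bsub>G\<^esub> ?P)) (g <#\<^bsub>G\<^esub> ?P)"
      using k g sub by (intro G.coarse_equal_l_coset) (auto simp: G.l_coset_subset_G)
    then have 1: "coarse_equal d\<^sub>G (a <#\<^bsub>G\<^esub> ?P) (g <#\<^bsub>G\<^esub> ?P)"
      using a g k sub by (simp add: G.lcos_m_assoc)
    have "coarse_equal d\<^sub>G ((a \<otimes>\<^bsub>G\<^esub> x) <#\<^bsub>G\<^esub> P) (g <#\<^bsub>G\<^esub> ?P)"
      by (rule G.coarse_equal_trans[OF G.coarse_equal_l_coset_conjugate 1])
        (use ac g x sub P.subset in \<open>simp_all add: G.l_coset_subset_G\<close>)
    then have 2: "coarse_equal d\<^sub>G ((a \<otimes>\<^bsub>G\<^esub> x) <#\<^bsub>G\<^esub> P) ((g \<otimes>\<^bsub>G\<^esub> x) <#\<^bsub>G\<^esub> P)"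
      by (rule G.coarse_equal_trans[OF _ coarse_equal_sym[OF G.coarse_equal_l_coset_conjugate]])
        (use ac g x sub P.subset in \<open>simp_all add: G.l_coset_subset_G\<close>)
    have co: "(a \<otimes>\<^bsub>G\<^esub> x) <#\<^bsub>G\<^esub> P \<in> left_cosets_of G \<P>"
      "(g \<otimes>\<^bsub>G\<^esub> x) <#\<^bsub>G\<^esub> P \<in> left_cosets_of G \<P>"
      using coset_in_G P ac g x by auto
    then obtain B' where B': "B' \<in> left_cosets_of H \<Q>"
      "hdist d\<^sub>H (q ` ((a \<otimes>\<^bsub>G\<^esub> x) <#\<^bsub>G\<^esub> P)) B' < ennreal M"
      using coset_partner by blast
    \<comment> \<open>Uniformity enters here: a coarse equality with unknown constant forces equal
      partners, and the partner relation carries the fixed constant \<open>M\<close>.\<close>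
    then have "B' = B" using partner_eq_of_coarse_equal[OF co(1) B' co(2) B AB 2] by simp
    moreover have "a \<otimes>\<^bsub>G\<^esub> x \<in> (a \<otimes>\<^bsub>G\<^esub> x) <#\<^bsub>G\<^esub> P"
      using G.lcos_self ac x P.subgroup_axioms by simp
    ultimately obtain b where b: "b \<in> B" "d\<^sub>H (q (a \<otimes>\<^bsub>G\<^esub> x)) b \<le> M"
      using hdist_less_imp(1)[OF B'(2)] by blast
    then show ?thesis using close ac coset_subset_H[OF B] by blast
  qed
  then show "\<forall>a\<in>q ` A. \<exists>b\<in>B. d\<^sub>H a b \<le> r" by blast
  have "\<exists>a\<in>A. d\<^sub>H (q a) b \<le> r" if "b \<in> B" for b
  proof -
    obtain p where p: "p \<in> P" "d\<^sub>H (q (g \<otimes>\<^bsub>G\<^esub> x \<otimes>\<^bsub>G\<^esub> p)) b \<le> M"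
      using hdist_less_imp(2)[OF AB] \<open>b \<in> B\<close> unfolding l_coset_def by blast
    \<comment> \<open>Chosen so that gkx = gxp, while \<open>k\<close> lies in the conjugate of
      \<open>P\<close> and hence in its commensurator.\<close>
    define k where "k = x \<otimes>\<^bsub>G\<^esub> p \<otimes>\<^bsub>G\<^esub> inv\<^bsub>G\<^esub> x"
    have "k \<in> ?P" using p by (auto simp: k_def G.conjugate_eq)
    then have "k \<in> commensurator G ?P" using G.subset_commensurator[OF sP] by blast
    then have "g \<otimes>\<^bsub>G\<^esub> k \<in> A" by (auto simp: A_def l_coset_def)
    moreover have "g \<otimes>\<^bsub>G\<^esub> k \<otimes>\<^bsub>G\<^esub> x = g \<otimes>\<^bsub>G\<^esub> x \<otimes>\<^bsub>G\<^esub> p" "g \<otimes>\<^bsub>G\<^esub> k \<in> carrier G"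
      using p g x by (simp_all add: k_def G.m_assoc)
    moreover have "b \<in> carrier H" using coset_subset_H[OF B] \<open>b \<in> B\<close> by blast
    ultimately have "d\<^sub>H (q (g \<otimes>\<^bsub>G\<^esub> k)) b \<le> r" using close p(2) by simp
    then show ?thesis using \<open>g \<otimes>\<^bsub>G\<^esub> k \<in> A\<close> by blast
  qed
  then show "\<forall>b\<in>B. \<exists>a\<in>q ` A. d\<^sub>H a b \<le> r" by blast
qed

text \<open>A common bound \<open>D\<close> on the norms of the conjugating elements makes the
  constant independent of \<open>P\<close>, \<open>g\<close> and \<open>x\<close>.\<close>

lemma commensurator_coset_hdist:
  assumes "P \<in> \<P>" "g \<in> carrier G" "x \<in> carrier G" "d\<^sub>G \<one>\<^bsub>G\<^esub> x \<le> D"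
    and "B \<in> left_cosets_of H \<Q>" "hdist d\<^sub>H (q ` ((g \<otimes>\<^bsub>G\<^esub> x) <#\<^bsub>G\<^esub> P)) B < ennreal M"
  shows "hdist d\<^sub>H (q ` (g <#\<^bsub>G\<^esub> commensurator G (conjugate G x P))) B < ennreal (M + (L * D + C) + 1)"
proof (rule hdist_less_succ)
  have 0: "L * d\<^sub>G \<one>\<^bsub>G\<^esub> x \<le> L * D" using assms(4) L_ge_one by simp
  have le: "M + (L * d\<^sub>G \<one>\<^bsub>G\<^esub> x + C) \<le> M + (L * D + C)" using 0 by simp
  note near = commensurator_coset_near_partner[OF assms(1-3,5,6)]
  show "\<forall>a\<in>q ` (g <#\<^bsub>G\<^esub> commensurator G (conjugate G x P)). \<exists>b\<in>B. d\<^sub>H a b \<le> M + (L * D + C)"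
    using near(1) order_trans[OF _ le] by blast
  show "\<forall>b\<in>B. \<exists>a\<in>q ` (g <#\<^bsub>G\<^esub> commensurator G (conjugate G x P)). d\<^sub>H a b \<le> M + (L * D + C)"
    using near(2) order_trans[OF _ le] by blast
  have "0 \<le> L * d\<^sub>G \<one>\<^bsub>G\<^esub> x" using L_ge_one by (simp add: word_dist_def)
  then show "0 \<le> M + (L * D + C)" using 0 M_nonneg C_nonneg by linarith
qed

lemma commensurator_subset: "commensurator G K \<subseteq> carrier G"
  by (auto simp: commensurator_def)

text \<open>Both sets have images near the same partner, and \<open>q\<close> reflects coarse
  equality. So passing from a subgroup to its commensurator does not change its coarse
  class.\<close>

lemma commensurator_coset_coarse_equal:
  assumes P: "P \<in> \<P>" and g: "g \<in> carrier G" and x: "x \<in> carrier G"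
  shows "coarse_equal d\<^sub>G (g <#\<^bsub>G\<^esub> commensurator G (conjugate G x P)) ((g \<otimes>\<^bsub>G\<^esub> x) <#\<^bsub>G\<^esub> P)"
proof -
  let ?A = "(g \<otimes>\<^bsub>G\<^esub> x) <#\<^bsub>G\<^esub> P" and ?R = "g <#\<^bsub>G\<^esub> commensurator G (conjugate G x P)"
  have A: "?A \<in> left_cosets_of G \<P>" using coset_in_G assms by simp
  then obtain B where B: "B \<in> left_cosets_of H \<Q>" "hdist d\<^sub>H (q ` ?A) B < ennreal M"
    using coset_partner by blast
  have sub: "?A \<subseteq> carrier G" "?R \<subseteq> carrier G" "B \<subseteq> carrier H"
    using A coset_subset_G coset_subset_H B g commensurator_subset by (auto simp: G.l_coset_subset_G)
  have 1: "coarse_equal d\<^sub>H (q ` ?R) B"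
    using commensurator_coset_hdist[OF assms order_refl B] sub image_subset
    by (intro H.hdist_less_imp_coarse_equal) auto
  have "coarse_equal d\<^sub>H (q ` ?R) (q ` ?A)"
    by (rule H.coarse_equal_trans[OF 1 coarse_equal_sym[OF partner_coarse_equal[OF A B]]])
      (use sub image_subset in auto)
  then show ?thesis using quasi_isometry_coarse_equal_iff[OF qi] sub by blast
qed

lemma commensurator_coset_coarse_equal':
  assumes P: "P \<in> \<P>" and g: "g \<in> carrier G" and x: "x \<in> carrier G"
  shows "coarse_equal d\<^sub>G (g <#\<^bsub>G\<^esub> commensurator G (conjugate G x P)) (g <#\<^bsub>G\<^esub> conjugate G x P)"
  by (rule G.coarse_equal_trans[OF commensurator_coset_coarse_equal G.coarse_equal_l_coset_conjugate])
    (use assms subgroup.subset[OF subgroup_G[OF P]] G.conjugate_subset commensurator_subset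
      in \<open>simp_all add: G.l_coset_subset_G\<close>)

section \<open>Refinements: finiteness, almost malnormality and the quasi-isometry of pairs\<close>

lemma refinementD:
  assumes "refinement G \<P> \<R>" "R \<in> \<R>"
  obtains P x where "P \<in> \<P>" "x \<in> carrier G" "R = commensurator G (conjugate G x P)"
  using assms unfolding refinement_def commensurators_of_conjugates_def by blast

lemma refinement_unique:
  assumes "refinement G \<P> \<R>" "R \<in> \<R>" "R' \<in> \<R>" "g \<in> carrier G" "R' = conjugate G g R"
  shows "R = R'"
proof -
  have "R \<in> commensurators_of_conjugates G \<P>" using assms unfolding refinement_def by blast
  then have "\<exists>!K. K \<in> \<R> \<and> K \<in> conjugacy_class G R" using assms(1) unfolding refinement_def by blast
  moreover have "R \<subseteq> carrier G"
    using refinementD[OF assms(1,2)] commensurator_subset by blast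
  then have "R \<in> conjugacy_class G R" unfolding conjugacy_class_def
    using G.conjugate_one by (metis G.one_closed imageI)
  moreover have "R' \<in> conjugacy_class G R" unfolding conjugacy_class_def using assms by blast
  ultimately show ?thesis using assms by blast
qed

lemma commensurator_in_commensurators_of_conjugates:
  assumes "P \<in> \<P>"
  shows "commensurator G P \<in> commensurators_of_conjugates G \<P>"
proof -
  have "commensurator G P = commensurator G (conjugate G \<one>\<^bsub>G\<^esub> P)"
    using G.conjugate_one subgroup.subset[OF subgroup_G[OF assms]] by simp
  then show ?thesis
    unfolding commensurators_of_conjugates_def using assms G.one_closed by blast
qed

text \<open>The representative of the class of \<open>commensurator G P\<close> is a conjugate of
  it, and conjugation commutes with commensurators; so the representative can be written using this
  given \<open>P\<close>.\<close>

lemma refinement_representative: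
  assumes "refinement G \<P> \<R>" and P: "P \<in> \<P>"
  obtains R y where "R \<in> \<R>" "y \<in> carrier G" "R = commensurator G (conjugate G y P)"
proof -
  have sP: "subgroup P G" using subgroup_G P .
  then obtain R where "R \<in> \<R>" "R \<in> conjugacy_class G (commensurator G P)"
    using assms commensurator_in_commensurators_of_conjugates unfolding refinement_def by blast
  moreover from this obtain y where "y \<in> carrier G" "R = conjugate G y (commensurator G P)"
    unfolding conjugacy_class_def by blast
  ultimately show ?thesis using that G.commensurator_conjugate[OF sP] by simp
qed

text \<open>Every member of \<open>\<R>\<close> represents the class of
  \<open>commensurator G P\<close> for some \<open>P\<close> in \<open>\<P>\<close>, so
  \<open>\<R>\<close> is covered by an image of \<open>\<P>\<close>.\<close>

lemma finite_refinement:
  assumes ref: "refinement G \<P> \<R>" and fin: "finite \<P>"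
  shows "finite \<R>"
proof (rule finite_surj[OF fin])
  let ?f = "\<lambda>P. THE R. R \<in> \<R> \<and> R \<in> conjugacy_class G (commensurator G P)"
  show "\<R> \<subseteq> ?f ` \<P>"
  proof
    fix R assume R: "R \<in> \<R>"
    then obtain P x where P: "P \<in> \<P>" "x \<in> carrier G" "R = commensurator G (conjugate G x P)"
      using refinementD ref by blast
    have sP: "subgroup P G" using subgroup_G P(1) .
have "\<exists>!R. R \<in> \<R> \<and> R \<in> conjugacy_class G (commensurator G P)"
      using ref P(1) commensurator_in_commensurators_of_conjugates unfolding refinement_def by blast
    moreover have "R \<in> conjugacy_class G (commensurator G P)"
      using P G.commensurator_conjugate[OF sP] unfolding conjugacy_class_def by blast
    ultimately have "?f P = R" using R by (intro the1_equality) auto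
    then show "R \<in> ?f ` \<P>" using P by blast
  qed
qed

lemma almost_malnormal_refinement:
  assumes ref: "refinement G \<P> \<R>"
  shows "almost_malnormal G \<R>"
  unfolding almost_malnormal_def
proof (intro ballI)
  fix R R' g assume R: "R \<in> \<R>" and R': "R' \<in> \<R>" and g: "g \<in> carrier G"
  obtain P x where P: "P \<in> \<P>" "x \<in> carrier G" "R = commensurator G (conjugate G x P)"
    using refinementD ref R by blast
  obtain P' x' where P': "P' \<in> \<P>" "x' \<in> carrier G" "R' = commensurator G (conjugate G x' P')"
    using refinementD ref R' by blast
  define K where "K = conjugate G x P"
  define K' where "K' = conjugate G x' P'"
  have sK: "subgroup K G" "subgroup K' G"
    using P P' subgroup_G G.subgroup_conjugate by (auto simp: K_def K'_def)
  then have sgK: "subgroup (conjugate G g K) G" using G.subgroup_conjugate g by blast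
  have Rsub: "R \<subseteq> carrier G" "R' \<subseteq> carrier G" using P P' commensurator_subset by auto
  \<comment> \<open>These cosets of members of \<open>\<P>\<close> are coarsely equal to gR and R';
    the factor \<open>\<one>\<close> lets the coset lemmas apply to \<open>R'\<close>
    itself.\<close>
  let ?A = "(g \<otimes>\<^bsub>G\<^esub> x) <#\<^bsub>G\<^esub> P" and ?A' = "(\<one>\<^bsub>G\<^esub> \<otimes>\<^bsub>G\<^esub> x') <#\<^bsub>G\<^esub> P'"
  have A: "?A \<in> left_cosets_of G \<P>" "?A' \<in> left_cosets_of G \<P>"
    using coset_in_G P P' g by auto
  have sub: "?A \<subseteq> carrier G" "?A' \<subseteq> carrier G" "g <#\<^bsub>G\<^esub> R \<subseteq> carrier G" "g <#\<^bsub>G\<^esub> K \<subseteq> carrier G"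
    "conjugate G g R \<subseteq> carrier G" "conjugate G g K \<subseteq> carrier G" "K \<subseteq> carrier G" "K' \<subseteq> carrier G"
    using coset_subset_G[OF A(1)] coset_subset_G[OF A(2)] subgroup.subset[OF sK(1)]
      subgroup.subset[OF sK(2)] subgroup.subset[OF sgK] G.conjugate_subset[OF Rsub(1) g] Rsub g
    by (simp_all add: G.l_coset_subset_G)
  have gR_gK: "coarse_equal d\<^sub>G (g <#\<^bsub>G\<^esub> R) (g <#\<^bsub>G\<^esub> K)"
    using commensurator_coset_coarse_equal' P g by (simp add: K_def)
  have gR_A: "coarse_equal d\<^sub>G (g <#\<^bsub>G\<^esub> R) ?A"
    using commensurator_coset_coarse_equal P g by simp
  have R_K: "coarse_equal d\<^sub>G R K"
    using commensurator_coset_coarse_equal'[OF P(1) G.one_closed P(2)] P(3) Rsub sub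
    by (simp add: K_def G.lcos_mult_one)
  have R'_A': "coarse_equal d\<^sub>G R' ?A'"
    using commensurator_coset_coarse_equal[OF P'(1) G.one_closed P'(2)] P'(3) Rsub
    by (simp add: G.lcos_mult_one)
  have R'_K': "coarse_equal d\<^sub>G R' K'"
    using commensurator_coset_coarse_equal'[OF P'(1) G.one_closed P'(2)] P'(3) Rsub sub
    by (simp add: K'_def G.lcos_mult_one)
  have gR_cR: "coarse_equal d\<^sub>G (g <#\<^bsub>G\<^esub> R) (conjugate G g R)"
    using G.coarse_equal_conjugate Rsub g by blast
  have gK_cK: "coarse_equal d\<^sub>G (g <#\<^bsub>G\<^esub> K) (conjugate G g K)"
    using G.coarse_equal_conjugate sub g by blast
  show "finite (conjugate G g R \<inter> R') \<or> (R = R' \<and> g \<in> R)"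
  proof (cases "finite (conjugate G g R \<inter> R')")
    case False
    have cR_A: "coarse_equal d\<^sub>G (conjugate G g R) ?A"
      by (rule G.coarse_equal_trans[OF coarse_equal_sym[OF gR_cR] gR_A sub(5,3,1)])
    have "coarse_subset d\<^sub>G (conjugate G g R \<inter> R') R'"
      by (rule coarse_subset_mono[OF G.coarse_subset_refl[OF Rsub(2)]]) simp
    then have "coarse_overlap d\<^sub>G (conjugate G g R) R'"
      unfolding coarse_overlap_def using False by blast
    then have ov: "coarse_overlap d\<^sub>G ?A ?A'"
      by (rule G.coarse_overlap_trans)
        (use cR_A R'_A' sub Rsub in \<open>simp_all add: coarse_equal_def\<close>)
    obtain B where B: "B \<in> left_cosets_of H \<Q>" "hdist d\<^sub>H (q ` ?A) B < ennreal M"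
      using coset_partner A by blast
    obtain B' where B': "B' \<in> left_cosets_of H \<Q>" "hdist d\<^sub>H (q ` ?A') B' < ennreal M"
      using coset_partner A by blast
    have "B = B'" using partner_eq_of_coarse_overlap[OF A(1) B A(2) B' ov] .
    then have A_A': "coarse_equal d\<^sub>G ?A ?A'"
      using coarse_equal_of_partner_eq[OF A(1) B(2) A(2) _ B(1)] B'(2) by simp
    \<comment> \<open>The chain runs from the conjugate of \<open>K\<close> through gK, gR,
      \<open>?A\<close>, \<open>?A'\<close> and \<open>R'\<close> to \<open>K'\<close>; coarsely
      equal subgroups have the same commensurator.\<close>
    note gK_gR = coarse_equal_sym[OF gR_gK]
    have "coarse_equal d\<^sub>G (conjugate G g K) (g <#\<^bsub>G\<^esub> R)"
      by (rule G.coarse_equal_trans[OF coarse_equal_sym[OF gK_cK] gK_gR sub(6,4,3)])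
    then have "coarse_equal d\<^sub>G (conjugate G g K) ?A"
      by (rule G.coarse_equal_trans[OF _ gR_A sub(6,3,1)])
    then have "coarse_equal d\<^sub>G (conjugate G g K) ?A'"
      by (rule G.coarse_equal_trans[OF _ A_A' sub(6,1,2)])
    then have "coarse_equal d\<^sub>G (conjugate G g K) R'"
      by (rule G.coarse_equal_trans[OF _ coarse_equal_sym[OF R'_A'] sub(6,2) Rsub(2)])
    then have "coarse_equal d\<^sub>G (conjugate G g K) K'"
      by (rule G.coarse_equal_trans[OF _ R'_K' sub(6) Rsub(2) sub(8)])
    then have "commensurator G (conjugate G g K) = R'"
      using G.commensurator_cong[OF sgK sK(2)] P'(3) by (simp add: K'_def)
    then have conj: "R' = conjugate G g R"
      using G.commensurator_conjugate[OF sK(1) g] P(3) by (simp add: K_def)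
    then have RR': "R = R'" using refinement_unique[OF ref R R' g] by blast
    \<comment> \<open>Now \<open>R\<close> equals its own conjugate by \<open>g\<close>, so gR is
      coarsely \<open>R\<close>. Replacing \<open>R\<close> by \<open>K\<close> shows that
      \<open>g\<close> commensurates \<open>K\<close>.\<close>
    have "coarse_equal d\<^sub>G (g <#\<^bsub>G\<^esub> R) R" using gR_cR by (simp flip: conj RR')
    then have "coarse_equal d\<^sub>G (g <#\<^bsub>G\<^esub> K) R"
      by (rule G.coarse_equal_trans[OF gK_gR _ sub(4,3) Rsub(1)])
    then have "coarse_equal d\<^sub>G (g <#\<^bsub>G\<^esub> K) K"
      by (rule G.coarse_equal_trans[OF _ R_K sub(4) Rsub(1) sub(7)])
    then have "g \<in> R" using P(3) g G.commensurator_iff[OF sK(1)] by (simp add: K_def)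
    then show ?thesis using RR' by blast
  qed blast
qed

lemma quasi_isometry_of_pairs_refinement:
  assumes ref: "refinement G \<P> \<R>" and fin: "finite \<P>"
  shows "quasi_isometry_of_pairs G S \<R> H T \<Q> q"
proof -
  define conjugator where
    "conjugator P R y \<longleftrightarrow> y \<in> carrier G \<and> R = commensurator G (conjugate G y P)" for P R y
  \<comment> \<open>One conjugator is fixed for each pair: infinitely many may exist, and only a
    finite selection has bounded norm. Indexing by pairs serves both projections, one starting from
    \<open>R\<close> and the other from \<open>P\<close>.\<close>
  define Y where "Y = (\<lambda>(P, R). SOME y. conjugator P R y)"
  have Y: "conjugator P R (Y (P, R))" if "conjugator P R y" for P R y
    unfolding Y_def using that by (simp add: someI)
  have finY: "finite ((\<lambda>y. d\<^sub>G \<one>\<^bsub>G\<^esub> y) ` Y ` (\<P> \<times> \<R>))"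
    using fin finite_refinement[OF ref fin] by simp
  define D where "D = Max ((\<lambda>y. d\<^sub>G \<one>\<^bsub>G\<^esub> y) ` Y ` (\<P> \<times> \<R>))"
  have D: "d\<^sub>G \<one>\<^bsub>G\<^esub> (Y (P, R)) \<le> D" if "P \<in> \<P>" "R \<in> \<R>" for P R
    unfolding D_def using finY that by (intro Max_ge) auto
  \<comment> \<open>If \<open>\<P>\<close> is empty, \<open>D\<close> is the unspecified maximum of
    the empty set; the outer maximum secures nonnegativity in every case.\<close>
  define M' where "M' = max 0 (M + (L * D + C) + 1)"
  have M': "hdist d\<^sub>H (q ` (g <#\<^bsub>G\<^esub> R)) B < ennreal M'"
    if "P \<in> \<P>" "R \<in> \<R>" "y = Y (P, R)" "conjugator P R y" "g \<in> carrier G" "B \<in> left_cosets_of H \<Q>"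
      "hdist d\<^sub>H (q ` ((g \<otimes>\<^bsub>G\<^esub> y) <#\<^bsub>G\<^esub> P)) B < ennreal M" for P R y g B
  proof -
    have "hdist d\<^sub>H (q ` (g <#\<^bsub>G\<^esub> R)) B < ennreal (M + (L * D + C) + 1)"
      using commensurator_coset_hdist[OF that(1,5) _ _ that(6,7)] that D by (auto simp: conjugator_def)
    also have "\<dots> \<le> ennreal M'" unfolding M'_def by (intro ennreal_leI) simp
    finally show ?thesis .
  qed
  have fst: "A \<in> fst ` coset_relation G \<R> H T \<Q> M' q" if A: "A \<in> left_cosets_of G \<R>" for A
  proof -
    obtain g R where R: "R \<in> \<R>" "g \<in> carrier G" "A = g <#\<^bsub>G\<^esub> R"
      using A unfolding G.left_cosets_of_eq by blast
    then obtain P x where P: "P \<in> \<P>" "conjugator P R x"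
      using refinementD ref unfolding conjugator_def by metis
    define y where "y = Y (P, R)"
    have y: "conjugator P R y" using Y P by (simp add: y_def)
    have "(g \<otimes>\<^bsub>G\<^esub> y) <#\<^bsub>G\<^esub> P \<in> left_cosets_of G \<P>"
      using coset_in_G P R y by (simp add: conjugator_def)
    then obtain B where "B \<in> left_cosets_of H \<Q>" "hdist d\<^sub>H (q ` ((g \<otimes>\<^bsub>G\<^esub> y) <#\<^bsub>G\<^esub> P)) B < ennreal M"
      using coset_partner by blast
    then have "(A, B) \<in> coset_relation G \<R> H T \<Q> M' q"
      using M'[OF P(1) R(1) y_def y R(2)] R A by (simp add: coset_relation_def)
    then show ?thesis by force
  qed
  have snd: "B \<in> snd ` coset_relation G \<R> H T \<Q> M' q" if B: "B \<in> left_cosets_of H \<Q>" for B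
  proof -
    obtain A where A: "A \<in> left_cosets_of G \<P>" "hdist d\<^sub>H (q ` A) B < ennreal M"
      using coset_partner' B by blast
    then obtain g P where P: "P \<in> \<P>" "g \<in> carrier G" "A = g <#\<^bsub>G\<^esub> P"
      unfolding G.left_cosets_of_eq by blast
    obtain R x where R: "R \<in> \<R>" "conjugator P R x"
      using refinement_representative[OF ref P(1)] unfolding conjugator_def by metis
    define y where "y = Y (P, R)"
    have y: "conjugator P R y" using Y R by (simp add: y_def)
    then have yc: "y \<in> carrier G" by (simp add: conjugator_def)
    \<comment> \<open>Then (hy)P = gP, so hR is the coset of \<open>R\<close> attached to the given
      coset of \<open>P\<close>.\<close>
    define h where "h = g \<otimes>\<^bsub>G\<^esub> inv\<^bsub>G\<^esub> y"
    have h: "h \<in> carrier G" "h \<otimes>\<^bsub>G\<^esub> y = g" using P yc by (simp_all add: h_def G.m_assoc)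
    have "hdist d\<^sub>H (q ` (h <#\<^bsub>G\<^esub> R)) B < ennreal M'"
      using M'[OF P(1) R(1) y_def y h(1) B] A P h by simp
    moreover have "h <#\<^bsub>G\<^esub> R \<in> left_cosets_of G \<R>" using h R by (auto simp: G.left_cosets_of_eq)
    ultimately have "(h <#\<^bsub>G\<^esub> R, B) \<in> coset_relation G \<R> H T \<Q> M' q"
      using B by (simp add: coset_relation_def)
    then show ?thesis by force
  qed
  have "fst ` coset_relation G \<R> H T \<Q> M' q = left_cosets_of G \<R>"
    "snd ` coset_relation G \<R> H T \<Q> M' q = left_cosets_of H \<Q>"
    using fst snd by (auto simp: coset_relation_def)
  moreover have "0 \<le> M'" by (simp add: M'_def)
  ultimately have "quasi_isometry_of_pairs_with L C M' G S \<R> H T \<Q> q"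
    using qi by (simp add: quasi_isometry_of_pairs_with_def)
  then show ?thesis unfolding quasi_isometry_of_pairs_def by blast
qed

end

theorem theorem4:
  fixes G :: "('a, 'm) monoid_scheme" and H :: "('b, 'n) monoid_scheme"
    and S :: "'a set" and T :: "'b set"
    and \<P> :: "'a set set" and \<Q> :: "'b set set"
    and q :: "'a \<Rightarrow> 'b"
  assumes "group G" and "group H"
    and "finite_generating_set G S" and "finite_generating_set H T"
    and "finite \<P>" and "\<And>P. P \<in> \<P> \<Longrightarrow> subgroup P G"
    and "finite \<Q>" and "\<And>Q. Q \<in> \<Q> \<Longrightarrow> subgroup Q H"
    and "quasi_isometry_of_pairs G S \<P> H T \<Q> q"
    and "almost_malnormal H \<Q>" and "\<And>Q. Q \<in> \<Q> \<Longrightarrow> infinite Q"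
  shows "\<forall>\<P>star. refinement G \<P> \<P>star \<longrightarrow>
           almost_malnormal G \<P>star \<and> quasi_isometry_of_pairs G S \<P>star H T \<Q> q"
proof -
  interpret G: group G by fact
  interpret H: group H by fact
  obtain L C M where "quasi_isometry_of_pairs_with L C M G S \<P> H T \<Q> q"
    using assms(9) unfolding quasi_isometry_of_pairs_def by blast
  then interpret quasi_isometry_of_pairs_almost_malnormal G S H T \<P> \<Q> q L C M
    using assms
    by (intro quasi_isometry_of_pairs_almost_malnormal.intro finitely_generated_group.intro
        finitely_generated_group_axioms.intro quasi_isometry_of_pairs_almost_malnormal_axioms.intro)
  show ?thesis
    using almost_malnormal_refinement quasi_isometry_of_pairs_refinement assms(5) by blast
qed

end
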